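(* Let $d\ge1$, $\boldsymbol\beta\in(0,\infty)^d$ and $\frac1\beta=\frac1d\sum_{j=1}^d\frac1{\beta_j}$. For $b>0$ let $p_b$ denote the isotropic, centered Gaussian density on $\mathbb R^d$ with $\|p_b\|_{\infty,\mu}=b$. There is a constant $C>0$ depending only on $\boldsymbol\beta,d$ such that for all $\mathbf L=(L_1,\dots,L_d)\in(0,\infty)^d$, all $b>0$ such that $p_b\in\mathcal C^{\boldsymbol\beta}_{\mathbf L/2,+\infty}$, and all large enough $n$, $$\inf_{\tilde p}\ \sup_{p^\star\in\mathcal P^{\boldsymbol\beta}_{\mathbf L,b}}\mathbb E\bigl[\|\tilde p-p^\star\|_{\infty,\mu}\bigr]\ge C\,b^{\frac\beta{2\beta+d}}\left(\prod_{j=1}^dL_j^{\frac\beta{\beta_j}}\right)^{\frac1{2\beta+d}}\left(\frac{\log n}n\right)^{\frac\beta{2\beta+d}},$$ where the infimum runs over all estimators computed from an i.i.d. $n$-sample drawn from $p^\star$.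
   Context: $\mu$ is Lebesgue measure on $\mathbb R^d$ and $\|\cdot\|_{\infty,\mu}$ the essential supremum norm. $C^{\boldsymbol\beta}(\mathbb R^d)$ is the space of functions $f$ admitting partial derivatives $\partial^{k_i}f/\partial x_i^{k_i}$ for all $k_i\le\lfloor\beta_i\rfloor$, $i=1,\dots,d$, and such that for all $i$ $$|f|_{i,\beta_i}:=\sup_{x\in\mathbb R^d}\sup_{t\ne0}\frac1{|t|^{\beta_i-\lfloor\beta_i\rfloor}}\left|\frac{\partial^{\lfloor\beta_i\rfloor}f}{\partial x_i^{\lfloor\beta_i\rfloor}}(x+te_i)-\frac{\partial^{\lfloor\beta_i\rfloor}f}{\partial x_i^{\lfloor\beta_i\rfloor}}(x)\right|<\infty,$$ $(e_i)$ being the standard basis. For $b\in(0,+\infty]$, $\mathcal C^{\boldsymbol\beta}_{\mathbf L,b}=\{p\in C^{\boldsymbol\beta}(\mathbb R^d):\|p\|_{\infty,\mu}\le b,\ |p|_{j,\beta_j}\le L_j\ \forall j\}$, and $\mathcal P^{\boldsymbol\beta}_{\mathbf L,b}$ is the set of probability density functions belonging to $\mathcal C^{\boldsymbol\beta}_{\mathbf L,b}$. "Large enough $n$" may depend on $\mathbf L,b,\boldsymbol\beta,d$. *)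

theory Defs
  imports "HOL-Probability.Probability"
begin

text \<open>
  Points of \<open>d\<close>-dimensional space have type \<open>real ^ 'd\<close>, so \<open>d\<close> is \<open>CARD('d)\<close>; the smoothness
  vector \<open>\<beta>\<close> and the vector \<open>L\<close> of Hoelder constants have the same type.
\<close>

definition linf_norm :: "(real ^ 'd \<Rightarrow> real) \<Rightarrow> ennreal" where
  "linf_norm f = esssup lborel (\<lambda>x. ennreal \<bar>f x\<bar>)"


definition partial_deriv :: "'d \<Rightarrow> (real ^ 'd \<Rightarrow> real) \<Rightarrow> (real ^ 'd \<Rightarrow> real)" where
  "partial_deriv i f = (\<lambda>x. deriv (\<lambda>t. f (x + t *\<^sub>R axis i 1)) 0)"

definition has_partial_derivs :: "'d \<Rightarrow> nat \<Rightarrow> (real ^ 'd \<Rightarrow> real) \<Rightarrow> bool" where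
  "has_partial_derivs i m f \<longleftrightarrow>
     (\<forall>k<m. \<forall>x. (\<lambda>t. (partial_deriv i ^^ k) f (x + t *\<^sub>R axis i 1)) differentiable (at 0))"

definition holder_seminorm :: "'d \<Rightarrow> real \<Rightarrow> (real ^ 'd \<Rightarrow> real) \<Rightarrow> ennreal" where
  "holder_seminorm i b f =
     (SUP x. SUP t\<in>-{0}.
        ennreal (1 / \<bar>t\<bar> powr (b - of_int \<lfloor>b\<rfloor>) *
          \<bar>(partial_deriv i ^^ nat \<lfloor>b\<rfloor>) f (x + t *\<^sub>R axis i 1)
            - (partial_deriv i ^^ nat \<lfloor>b\<rfloor>) f x\<bar>))"

definition holder_space :: "real ^ 'd \<Rightarrow> (real ^ 'd \<Rightarrow> real) set" where
  "holder_space \<beta> =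
     {f. \<forall>i. has_partial_derivs i (nat \<lfloor>\<beta> $ i\<rfloor>) f \<and> holder_seminorm i (\<beta> $ i) f < \<infinity>}"

definition holder_class :: "real ^ 'd \<Rightarrow> real ^ 'd \<Rightarrow> ennreal \<Rightarrow> (real ^ 'd \<Rightarrow> real) set" where
  "holder_class \<beta> L b =
     {p \<in> holder_space \<beta>. linf_norm p \<le> b \<and> (\<forall>j. holder_seminorm j (\<beta> $ j) p \<le> ennreal (L $ j))}"

definition holder_densities :: "real ^ 'd \<Rightarrow> real ^ 'd \<Rightarrow> ennreal \<Rightarrow> (real ^ 'd \<Rightarrow> real) set" where
  "holder_densities \<beta> L b =
     {p \<in> holder_class \<beta> L b. p \<in> borel_measurable lborel \<and> (\<forall>x. 0 \<le> p x) \<and>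
        (\<integral>\<^sup>+x. ennreal (p x) \<partial>lborel) = 1}"


definition gaussian :: "real \<Rightarrow> real ^ 'd \<Rightarrow> real" where
  "gaussian \<sigma> x = (\<Prod>i\<in>UNIV. normal_density 0 \<sigma> (x $ i))"

definition gaussian_with_peak :: "real \<Rightarrow> real ^ 'd \<Rightarrow> real" where
  "gaussian_with_peak b =
     gaussian (THE \<sigma>. 0 < \<sigma> \<and> linf_norm (gaussian \<sigma> :: real ^ 'd \<Rightarrow> real) = ennreal b)"


definition iid_sample :: "nat \<Rightarrow> (real ^ 'd \<Rightarrow> real) \<Rightarrow> (nat \<Rightarrow> real ^ 'd) measure" where
  "iid_sample n p = PiM {..<n} (\<lambda>_. density lborel (\<lambda>x. ennreal (p x)))"

text \<open>
  An estimator sends a sample to a function. The measurability imposed is the least that gives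
  meaning to the sup-norm loss: each estimate is measurable, and so is the distance from the
  estimate to any fixed function, as a function of the sample. No property of the estimate (being
  a density, smoothness, boundedness) is required. Jointly measurable estimators satisfy this, see
  \<open>jointly_measurable_estimator\<close> below.
\<close>

definition estimators :: "nat \<Rightarrow> ((nat \<Rightarrow> real ^ 'd) \<Rightarrow> real ^ 'd \<Rightarrow> real) set" where
  "estimators n =
     {e. (\<forall>X\<in>space (PiM {..<n} (\<lambda>_. borel)). e X \<in> borel_measurable borel) \<and>
         (\<forall>g\<in>borel_measurable borel.
            (\<lambda>X. linf_norm (\<lambda>x. e X x - g x)) \<in> borel_measurable (PiM {..<n} (\<lambda>_. borel)))}"

definition risk :: "nat \<Rightarrow> ((nat \<Rightarrow> real ^ 'd) \<Rightarrow> real ^ 'd \<Rightarrow> real) \<Rightarrow> (real ^ 'd \<Rightarrow> real) \<Rightarrow> ennreal" where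
  "risk n e p = (\<integral>\<^sup>+X. linf_norm (\<lambda>x. e X x - p x) \<partial>iid_sample n p)"

definition minimax_risk :: "nat \<Rightarrow> (real ^ 'd \<Rightarrow> real) set \<Rightarrow> ennreal" where
  "minimax_risk n P = (INF e\<in>estimators n. SUP p\<in>P. risk n e p)"


subsection \<open>Well-definedness of the estimators and of the Gaussian with prescribed peak\<close>

lemma jointly_measurable_estimator:
  assumes [measurable]: "(\<lambda>(X, x). e X x) \<in> borel_measurable (PiM {..<n} (\<lambda>_. borel) \<Otimes>\<^sub>M borel)"
  shows "e \<in> estimators n"
proof -
  have "(\<lambda>X. linf_norm (\<lambda>x. e X x - g x)) \<in> borel_measurable (PiM {..<n} (\<lambda>_. borel))"
    if [measurable]: "g \<in> borel_measurable borel" for g :: "real ^ 'a \<Rightarrow> real"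
  proof (rule borel_measurableI_greater)
    let ?S = "PiM {..<n} (\<lambda>_. borel :: (real ^ 'a) measure)"
    fix c :: ennreal
    have gt: "c < linf_norm (\<lambda>x. e X x - g x) \<longleftrightarrow>
        (\<exists>k. emeasure lborel {x \<in> space lborel. ennreal \<bar>e X x - g x\<bar> > c + ennreal (1 / Suc k)} \<noteq> 0)"
      (is "?l \<longleftrightarrow> ?r") if X: "X \<in> space ?S" for X
    proof
      have [measurable]: "e X \<in> borel_measurable borel"
        using measurable_Pair2[OF assms X] by simp
      have le: "linf_norm (\<lambda>x. e X x - g x) \<le> z \<longleftrightarrow>
          emeasure lborel {x \<in> space lborel. ennreal \<bar>e X x - g x\<bar> > z} = 0" for z
      proof
        assume "linf_norm (\<lambda>x. e X x - g x) \<le> z"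
        moreover have "AE x in lborel. ennreal \<bar>e X x - g x\<bar> \<le> linf_norm (\<lambda>x. e X x - g x)"
          unfolding linf_norm_def by (rule esssup_AE)
        ultimately have "AE x in lborel. ennreal \<bar>e X x - g x\<bar> \<le> z"
          by (auto elim: eventually_mono)
        then show "emeasure lborel {x \<in> space lborel. ennreal \<bar>e X x - g x\<bar> > z} = 0"
          by (subst (asm) AE_iff_measurable[OF _ refl]) (auto simp: not_le)
      next
        assume "emeasure lborel {x \<in> space lborel. ennreal \<bar>e X x - g x\<bar> > z} = 0"
        then show "linf_norm (\<lambda>x. e X x - g x) \<le> z"
          unfolding linf_norm_def by (subst esssup_eq) (auto intro!: Inf_lower)
      qed
      { assume ?l
        then obtain z where z: "c < z" "z < linf_norm (\<lambda>x. e X x - g x)" using dense by blast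
        then have ctop: "c \<noteq> top" by auto
        have "(\<lambda>k. c + ennreal (1 / Suc k)) \<longlonglongrightarrow> c + ennreal 0"
          by (intro tendsto_intros LIMSEQ_Suc[OF lim_1_over_n])
        then have "\<forall>\<^sub>F k in sequentially. c + ennreal (1 / Suc k) < z"
          using z(1) by (intro order_tendstoD(2)) auto
        then obtain k where "c + ennreal (1 / Suc k) < z"
          by (auto simp: eventually_sequentially)
        then have "\<not> linf_norm (\<lambda>x. e X x - g x) \<le> c + ennreal (1 / Suc k)" using z by auto
        then show ?r using le by blast }
      { assume ?r
        then obtain k where "\<not> linf_norm (\<lambda>x. e X x - g x) \<le> c + ennreal (1 / Suc k)"
          using le by blast
        moreover have "c \<le> c + ennreal (1 / Suc k)" by simp
        ultimately show ?l by (meson not_le order.strict_trans1) }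
    qed
    have "Measurable.pred ?S (\<lambda>X. \<exists>k. emeasure lborel
        {x \<in> space lborel. ennreal \<bar>e X x - g x\<bar> > c + ennreal (1 / Suc k)} \<noteq> 0)"
      by measurable
    then show "{X \<in> space ?S. c < linf_norm (\<lambda>x. e X x - g x)} \<in> sets ?S"
      unfolding pred_def using gt by (simp cong: conj_cong)
  qed
  moreover have "e X \<in> borel_measurable borel" if "X \<in> space (PiM {..<n} (\<lambda>_. borel))" for X
    using measurable_Pair2[OF assms that] by simp
  ultimately show ?thesis by (auto simp: estimators_def)
qed

lemma linf_norm_gaussian:
  assumes "0 < \<sigma>"
  shows "linf_norm (gaussian \<sigma> :: real ^ 'd \<Rightarrow> real) = ennreal ((1 / sqrt (2 * pi * \<sigma>\<^sup>2)) ^ CARD('d))"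
proof -
  let ?g = "gaussian \<sigma> :: real ^ 'd \<Rightarrow> real"
  have peak: "?g 0 = (1 / sqrt (2 * pi * \<sigma>\<^sup>2)) ^ CARD('d)"
    by (simp add: gaussian_def normal_density_def)
  have nonneg: "0 \<le> ?g x" for x
    by (simp add: gaussian_def prod_nonneg)
  have le: "?g x \<le> ?g 0" for x
    unfolding gaussian_def by (intro prod_mono) (auto simp: normal_density_def divide_right_mono)
  have cont: "continuous_on UNIV ?g"
    unfolding gaussian_def[abs_def] normal_density_def using assms
    by (intro continuous_intros) auto
  then have meas[measurable]: "?g \<in> borel_measurable borel"
    by (rule borel_measurable_continuous_onI)
  have "linf_norm ?g \<le> ennreal (?g 0)"
    unfolding linf_norm_def using le nonneg
    by (subst esssup_eq_AE) (auto intro!: Inf_lower ennreal_leI)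
  moreover have "ennreal (?g 0) \<le> z" if "AE x in lborel. ennreal \<bar>?g x\<bar> \<le> z" for z
  proof (rule ccontr)
    assume "\<not> ennreal (?g 0) \<le> z"
    then obtain r where r: "0 \<le> r" "z = ennreal r" "r < ?g 0"
      using nonneg by (cases z) (auto simp: not_le ennreal_less_iff)
    have op: "open {x. r < ?g x}"
      using cont by (intro open_Collect_less) auto
    have "AE x in lborel. \<not> r < ?g x"
      using that by eventually_elim (use r nonneg in \<open>auto simp: not_less\<close>)
    then have "emeasure lborel {x. r < ?g x} = 0"
      by (subst (asm) AE_iff_measurable[OF _ refl]) auto
    then have "negligible {x. r < ?g x}"
      by (simp add: negligible_iff_emeasure0 op)
    then show False
      using open_not_negligible[OF op] r(3) by blast
  qed
  then have "ennreal (?g 0) \<le> linf_norm ?g"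
    unfolding linf_norm_def by (subst esssup_eq_AE) (auto intro!: Inf_greatest)
  ultimately show ?thesis using peak by simp
qed

lemma gaussian_with_peak_eq:
  assumes "0 < b"
  shows "(gaussian_with_peak b :: real ^ 'd \<Rightarrow> real)
    = gaussian (1 / (sqrt (2 * pi) * root CARD('d) b))" (is "_ = gaussian ?s")
    and "linf_norm (gaussian_with_peak b :: real ^ 'd \<Rightarrow> real) = ennreal b"
proof -
  have s: "0 < ?s" using assms by simp
  have sq: "sqrt (2 * pi * \<sigma>\<^sup>2) = sqrt (2 * pi) * \<sigma>" if "0 < \<sigma>" for \<sigma>
    using that by (simp add: real_sqrt_mult)
  have peak: "linf_norm (gaussian ?s :: real ^ 'd \<Rightarrow> real) = ennreal b"
    unfolding linf_norm_gaussian[OF s] sq[OF s] using assms by simp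
  moreover have "\<sigma> = ?s" if "0 < \<sigma>" "linf_norm (gaussian \<sigma> :: real ^ 'd \<Rightarrow> real) = ennreal b" for \<sigma>
  proof -
    have "(1 / (sqrt (2 * pi) * \<sigma>)) ^ CARD('d) = b"
      using that assms by (simp add: linf_norm_gaussian sq)
    then have "root CARD('d) b = 1 / (sqrt (2 * pi) * \<sigma>)"
      using that(1) by (intro real_root_pos_unique) auto
    then show ?thesis using that(1) by simp
  qed
  ultimately have "(THE \<sigma>. 0 < \<sigma> \<and> linf_norm (gaussian \<sigma> :: real ^ 'd \<Rightarrow> real) = ennreal b) = ?s"
    using s by (intro the_equality) blast+
  then show "(gaussian_with_peak b :: real ^ 'd \<Rightarrow> real) = gaussian ?s"
    and "linf_norm (gaussian_with_peak b :: real ^ 'd \<Rightarrow> real) = ennreal b"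
    using peak by (simp_all add: gaussian_with_peak_def)
qed

end

theory Submission
  imports Defs
begin

text \<open>
  Around a point where the Gaussian \<open>p\<^sub>b\<close> takes the value \<open>b / 2\<close>, add one of \<open>K\<close> disjoint bumps of
  integral zero, of height of order \<open>h\<close> and of width \<open>w\<^sub>i = (h / L\<^sub>i)\<close> to the power \<open>1 / \<beta>\<^sub>i\<close> in direction
  \<open>i\<close>; then each bump spends at most the remaining half of the Hoelder budget. Since the bumps are
  disjoint, the likelihood ratios of the \<open>K\<close> perturbed samples with respect to the Gaussian sample
  have cross moments 1 and second moments at most \<open>exp (n \<kappa>)\<close>, where
  \<open>\<kappa>\<close>, of order \<open>h\<^sup>2 \<Prod> w\<^sub>i / b\<close>, bounds the chi-square divergence.
  As soon as \<open>exp (n \<kappa>) \<le> K / 4\<close>, the Gaussian cannot be told from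
  the uniform mixture of its perturbations, which costs an error of order \<open>h\<close> in sup norm.
\<close>

subsection \<open>The sup norm\<close>

text \<open>The point of value b/2 is chosen because both constraints of the class are slack there:
  on a small cube around it the density stays in [b/4, 3b/4], so a perturbation of size at most b/4
  breaks neither nonnegativity nor the sup bound b. That the density is of order b there is also
  what brings b into the divergence and hence into the rate. The logarithm comes from the number of
  hypotheses: a mixture of K disjoint perturbations tolerates n \<kappa> up to order log K, and K is
  polynomial in n. Balancing h^2 * prod w_i / b against (log n) / n, where prod w_i = h^(d/\<beta>)
  / prod L_i^(1/\<beta>_i), determines h and the exponent \<beta> / (2 \<beta> + d). The obstacle is
  uniformity, since C may depend neither on b nor on L. The size of the cube depends on b, but it
  only limits the number and the widths of the bumps, so it decides how large n must be and leaves C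
  untouched.\<close>

lemma linf_norm_leI:
  assumes "f \<in> borel_measurable borel" "\<And>x. \<bar>f x\<bar> \<le> c"
  shows "linf_norm f \<le> ennreal c"
  unfolding linf_norm_def using assms by (intro esssup_I) (auto intro!: ennreal_leI)

text \<open>A strict superlevel set of a continuous function is open, and a nonempty open set is not
  a null set. Pointwise values can therefore be compared with the essential supremum.\<close>

lemma linf_norm_ge_at:
  fixes f :: "real ^ 'd \<Rightarrow> real"
  assumes cont: "continuous_on UNIV f"
  shows "ennreal \<bar>f x\<bar> \<le> linf_norm f"
proof (rule ccontr)
  assume "\<not> ennreal \<bar>f x\<bar> \<le> linf_norm f"
  then obtain r where r: "0 \<le> r" "linf_norm f = ennreal r" "r < \<bar>f x\<bar>"
    by (cases "linf_norm f") (auto simp: not_le ennreal_less_iff)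
  have op: "open {y. r < \<bar>f y\<bar>}"
    using cont by (intro open_Collect_less continuous_intros) auto
  have "AE y in lborel. ennreal \<bar>f y\<bar> \<le> linf_norm f"
    unfolding linf_norm_def by (rule esssup_AE)
  then have "AE y in lborel. \<not> r < \<bar>f y\<bar>"
    by eventually_elim (use r in \<open>auto simp: not_less\<close>)
  then have "emeasure lborel {y. r < \<bar>f y\<bar>} = 0"
    using op by (subst (asm) AE_iff_measurable[OF _ refl]) auto
  then have "negligible {y. r < \<bar>f y\<bar>}"
    by (simp add: negligible_iff_emeasure0 op)
  then show False
    using open_not_negligible[OF op] r(3) by blast
qed

text \<open>Here \<open>f\<close> plays the estimate and \<open>g\<close>, \<open>h\<close> two
  candidate densities: if these are far apart, no estimate is close to both.\<close>

lemma linf_norm_triangle_diff: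
  fixes f g h :: "real ^ 'd \<Rightarrow> real"
  assumes [measurable]: "f \<in> borel_measurable borel" "g \<in> borel_measurable borel"
    "h \<in> borel_measurable borel"
  shows "linf_norm (\<lambda>x. g x - h x) \<le> linf_norm (\<lambda>x. f x - h x) + linf_norm (\<lambda>x. f x - g x)"
proof -
  have "AE x in lborel. ennreal \<bar>f x - h x\<bar> \<le> linf_norm (\<lambda>x. f x - h x)"
    "AE x in lborel. ennreal \<bar>f x - g x\<bar> \<le> linf_norm (\<lambda>x. f x - g x)"
    unfolding linf_norm_def by (rule esssup_AE)+
  then have "AE x in lborel. ennreal \<bar>g x - h x\<bar>
      \<le> linf_norm (\<lambda>x. f x - h x) + linf_norm (\<lambda>x. f x - g x)"
  proof eventually_elim
    case (elim x)
    have "ennreal \<bar>g x - h x\<bar> \<le> ennreal (\<bar>f x - h x\<bar> + \<bar>f x - g x\<bar>)"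
      by (intro ennreal_leI) linarith
    also have "\<dots> = ennreal \<bar>f x - h x\<bar> + ennreal \<bar>f x - g x\<bar>" by (simp add: ennreal_plus)
    also have "\<dots> \<le> linf_norm (\<lambda>x. f x - h x) + linf_norm (\<lambda>x. f x - g x)"
      using elim by (intro add_mono)
    finally show ?case .
  qed
  then show ?thesis
    unfolding linf_norm_def[of "\<lambda>x. g x - h x"] by (intro esssup_I) auto
qed

subsection \<open>Testing against a mixture\<close>

text \<open>A product measure is determined by its values on rectangles, and there the integral of
  the product density factorizes. This makes the likelihood ratio of an i.i.d. sample the product of
  the ratios of single observations.\<close>

lemma PiM_density:
  assumes I: "finite I" and M: "prob_space M" and [measurable]: "r \<in> borel_measurable M"
    and r0: "\<And>x. 0 \<le> r x" and N: "prob_space (density M (\<lambda>x. ennreal (r x)))"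
  shows "PiM I (\<lambda>_. density M (\<lambda>x. ennreal (r x)))
    = density (PiM I (\<lambda>_. M)) (\<lambda>X. ennreal (\<Prod>i\<in>I. r (X i)))"
proof -
  let ?N = "density M (\<lambda>x. ennreal (r x))"
  interpret M: product_sigma_finite "\<lambda>_. M"
    using M unfolding product_sigma_finite_def by (simp add: prob_space_imp_sigma_finite)
  interpret N: product_sigma_finite "\<lambda>_. ?N"
    using N unfolding product_sigma_finite_def by (simp add: prob_space_imp_sigma_finite)
  have "density (PiM I (\<lambda>_. M)) (\<lambda>X. ennreal (\<Prod>i\<in>I. r (X i))) = PiM I (\<lambda>_. ?N)"
  proof (rule N.PiM_eqI[OF I])
    show "sets (density (PiM I (\<lambda>_. M)) (\<lambda>X. ennreal (\<Prod>i\<in>I. r (X i)))) = sets (PiM I (\<lambda>_. ?N))"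
      by (simp cong: sets_PiM_cong)
  next
    fix A assume A: "\<And>i. i \<in> I \<Longrightarrow> A i \<in> sets ?N"
    then have A'[measurable]: "A i \<in> sets M" if "i \<in> I" for i using that by simp
    have "emeasure (density (PiM I (\<lambda>_. M)) (\<lambda>X. ennreal (\<Prod>i\<in>I. r (X i)))) (PiE I A)
      = (\<integral>\<^sup>+X. ennreal (\<Prod>i\<in>I. r (X i)) * indicator (PiE I A) X \<partial>PiM I (\<lambda>_. M))"
      using I A' by (intro emeasure_density) (auto intro: sets_PiM_I_finite)
    also have "\<dots> = (\<integral>\<^sup>+X. (\<Prod>i\<in>I. ennreal (r (X i)) * indicator (A i) (X i)) \<partial>PiM I (\<lambda>_. M))"
    proof (rule nn_integral_cong)
      fix X assume "X \<in> space (PiM I (\<lambda>_. M))"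
      then have "indicator (PiE I A) X = (\<Prod>i\<in>I. indicator (A i) (X i) :: ennreal)"
        using I by (auto simp: indicator_def space_PiM PiE_def Pi_iff prod_zero_iff)
      then show "ennreal (\<Prod>i\<in>I. r (X i)) * indicator (PiE I A) X
          = (\<Prod>i\<in>I. ennreal (r (X i)) * indicator (A i) (X i))"
        using r0 by (simp add: prod.distrib prod_ennreal)
    qed
    also have "\<dots> = (\<Prod>i\<in>I. \<integral>\<^sup>+x. ennreal (r x) * indicator (A i) x \<partial>M)"
      using A' by (intro M.product_nn_integral_prod I) auto
    also have "\<dots> = (\<Prod>i\<in>I. emeasure ?N (A i))"
      using A' by (intro prod.cong refl emeasure_density[symmetric]) auto
    finally show "emeasure (density (PiM I (\<lambda>_. M)) (\<lambda>X. ennreal (\<Prod>i\<in>I. r (X i)))) (PiE I A)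
        = (\<Prod>i\<in>I. emeasure ?N (A i))" .
  qed
  then show ?thesis ..
qed

text \<open>Pointwise \<open>1 - \<rho> \<le> (1 - \<rho>)\<^sup>2 + 1/4\<close> replaces the total variation distance between \<open>M\<close> and
  the mixture of density \<open>\<rho>\<close> by a second moment.\<close>

lemma mixture_testing_bound:
  fixes \<rho> :: "nat \<Rightarrow> 'a \<Rightarrow> real"
  assumes M: "prob_space M" and "0 < K" and [measurable]: "T \<in> sets M"
    and int: "\<And>k. k < K \<Longrightarrow> integrable M (\<rho> k)" "\<And>k. k < K \<Longrightarrow> (\<integral>x. \<rho> k x \<partial>M) = 1"
    and int2: "\<And>k l. k < K \<Longrightarrow> l < K \<Longrightarrow> integrable M (\<lambda>x. \<rho> k x * \<rho> l x)"
    and diag: "\<And>k. k < K \<Longrightarrow> (\<integral>x. \<rho> k x * \<rho> k x \<partial>M) \<le> real K / 4"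
    and off: "\<And>k l. k < K \<Longrightarrow> l < K \<Longrightarrow> k \<noteq> l \<Longrightarrow> (\<integral>x. \<rho> k x * \<rho> l x \<partial>M) \<le> 1"
  shows "measure M T \<le> (\<Sum>k<K. \<integral>x. \<rho> k x * indicator T x \<partial>M) / real K + 1/2"
proof -
  interpret prob_space M by fact
  define \<sigma> where "\<sigma> = (\<lambda>x. (\<Sum>k<K. \<rho> k x) / real K)"
  have i1: "integrable M \<sigma>" unfolding \<sigma>_def
    by (intro integrable_divide Bochner_Integration.integrable_sum int) auto
  have e1: "(\<integral>x. \<sigma> x \<partial>M) = 1"
    unfolding \<sigma>_def using int \<open>0 < K\<close> by (simp add: Bochner_Integration.integral_sum)
  have sq: "(\<sigma> x)\<^sup>2 = (\<Sum>k<K. \<Sum>l<K. \<rho> k x * \<rho> l x) / (real K)\<^sup>2" for x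
    unfolding \<sigma>_def by (simp add: power_divide power2_eq_square sum_product)
  have i2: "integrable M (\<lambda>x. (\<sigma> x)\<^sup>2)" unfolding sq
    by (intro integrable_divide Bochner_Integration.integrable_sum int2) auto
  have "(\<integral>x. (\<sigma> x)\<^sup>2 \<partial>M) = (\<Sum>k<K. \<Sum>l<K. \<integral>x. \<rho> k x * \<rho> l x \<partial>M) / (real K)\<^sup>2"
  proof -
    have "(\<integral>x. (\<Sum>k<K. \<Sum>l<K. \<rho> k x * \<rho> l x) \<partial>M) = (\<Sum>k<K. \<integral>x. (\<Sum>l<K. \<rho> k x * \<rho> l x) \<partial>M)"
      by (intro Bochner_Integration.integral_sum Bochner_Integration.integrable_sum int2) auto
    also have "\<dots> = (\<Sum>k<K. \<Sum>l<K. \<integral>x. \<rho> k x * \<rho> l x \<partial>M)"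
      by (intro sum.cong Bochner_Integration.integral_sum int2) auto
    finally show ?thesis unfolding sq by simp
  qed
  \<comment> \<open>The 1 is added on the diagonal too, so that the double sum is K * (K/4) + K^2.
    With mean 1, a second moment of 5/4 is a variance of at most 1/4.\<close>
  also have "\<dots> \<le> (\<Sum>k<K. \<Sum>l<K. (if k = l then real K / 4 else 0) + 1) / (real K)\<^sup>2"
    using diag off by (intro divide_right_mono sum_mono) (force simp: add_increasing2)+
  also have "\<dots> = (real K * (real K / 4 + real K)) / (real K)\<^sup>2"
    by (simp add: sum.distrib)
  also have "\<dots> = 5/4" using \<open>0 < K\<close> by (simp add: power2_eq_square field_simps)
  finally have e2: "(\<integral>x. (\<sigma> x)\<^sup>2 \<partial>M) \<le> 5/4" .
  have iT: "integrable M (\<lambda>x. \<sigma> x * indicator T x)"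
    using i1 by (intro integrable_real_mult_indicator) auto
  have iT': "integrable M (indicat_real T)"
    by (rule integrable_real_indicator) (auto simp: less_top[symmetric])
  have pt: "indicator T x - \<sigma> x * indicator T x \<le> ((\<sigma> x)\<^sup>2 - 2 * \<sigma> x + 1) + 1/4" for x
  proof -
    have "0 \<le> (\<sigma> x - 1/2)\<^sup>2" "0 \<le> (\<sigma> x - 1)\<^sup>2" by simp_all
    then show ?thesis by (cases "x \<in> T") (auto simp: power2_eq_square algebra_simps)
  qed
  have "measure M T - (\<integral>x. \<sigma> x * indicator T x \<partial>M) = (\<integral>x. indicator T x - \<sigma> x * indicator T x \<partial>M)"
    using iT iT' by (subst Bochner_Integration.integral_diff) auto
  also have "\<dots> \<le> (\<integral>x. ((\<sigma> x)\<^sup>2 - 2 * \<sigma> x + 1) + 1/4 \<partial>M)"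
    using iT iT' i1 i2 pt by (intro integral_mono) auto
  also have "\<dots> = (\<integral>x. (\<sigma> x)\<^sup>2 \<partial>M) - 2 * (\<integral>x. \<sigma> x \<partial>M) + 1 + 1/4"
    using i1 i2 by (simp add: prob_space)
  also have "\<dots> \<le> 1/2" using e1 e2 by simp
  finally have "measure M T \<le> (\<integral>x. \<sigma> x * indicator T x \<partial>M) + 1/2" by simp
  also have "(\<integral>x. \<sigma> x * indicator T x \<partial>M) = (\<Sum>k<K. \<integral>x. \<rho> k x * indicator T x \<partial>M) / real K"
  proof -
    have "(\<integral>x. (\<Sum>k<K. \<rho> k x * indicator T x) \<partial>M) = (\<Sum>k<K. \<integral>x. \<rho> k x * indicator T x \<partial>M)"
      by (intro Bochner_Integration.integral_sum integrable_real_mult_indicator int) auto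
    then show ?thesis unfolding \<sigma>_def by (simp only: sum_distrib_right times_divide_eq_left) simp
  qed
  finally show ?thesis .
qed

text \<open>An estimator yields the test event \<open>T\<close> that its distance to
  \<open>g\<close> is below \<open>s\<close>. Off \<open>T\<close> the loss under \<open>g\<close>
  is at least \<open>s\<close>; on \<open>T\<close>, as \<open>g\<close> and its perturbations are
  \<open>2 * s\<close> apart, the loss under every perturbation is at least \<open>s\<close>. By the
  testing bound, the probability of the complement of \<open>T\<close> under \<open>g\<close> and
  the average probability of \<open>T\<close> under the perturbations add up to at least 1/2, so one
  of the risks is at least \<open>s / 4\<close>.\<close>

lemma minimax_lower_bound:
  fixes g :: "real ^ 'd \<Rightarrow> real" and \<gamma> :: "nat \<Rightarrow> real ^ 'd \<Rightarrow> real"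
  assumes g: "g \<in> P" and pk: "\<And>k. k < K \<Longrightarrow> (\<lambda>x. g x + \<gamma> k x) \<in> P"
    and g_meas[measurable]: "g \<in> borel_measurable borel"
    and \<gamma>_meas: "\<And>k. k < K \<Longrightarrow> \<gamma> k \<in> borel_measurable borel"
    and pos: "\<And>x. 0 < g x" and nonneg: "\<And>k x. k < K \<Longrightarrow> 0 \<le> g x + \<gamma> k x"
    and one: "(\<integral>\<^sup>+x. ennreal (g x) \<partial>lborel) = 1"
    and \<gamma>_int: "\<And>k. k < K \<Longrightarrow> integrable lborel (\<gamma> k)" "\<And>k. k < K \<Longrightarrow> (\<integral>x. \<gamma> k x \<partial>lborel) = 0"
    and disj: "\<And>k l x. k < K \<Longrightarrow> l < K \<Longrightarrow> k \<noteq> l \<Longrightarrow> \<gamma> k x * \<gamma> l x = 0"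
    and chi_int: "\<And>k. k < K \<Longrightarrow> integrable lborel (\<lambda>x. (\<gamma> k x)\<^sup>2 / g x)"
    and chi: "\<And>k. k < K \<Longrightarrow> (\<integral>x. (\<gamma> k x)\<^sup>2 / g x \<partial>lborel) \<le> \<kappa>"
    and K: "0 < K" "(1 + \<kappa>) ^ n \<le> real K / 4"
    and sep: "\<And>k. k < K \<Longrightarrow> ennreal (2 * s) \<le> linf_norm (\<gamma> k)" and s: "0 \<le> s"
  shows "ennreal (s / 4) \<le> minimax_risk n P"
  unfolding minimax_risk_def
proof (rule INF_greatest)
  fix e :: "(nat \<Rightarrow> real ^ 'd) \<Rightarrow> real ^ 'd \<Rightarrow> real" assume e: "e \<in> estimators n"
  define M where "M = density lborel (\<lambda>x. ennreal (g x))"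
  \<comment> \<open>Likelihood ratio of one observation. Its cross moments under \<open>g\<close>
    are 1 by disjointness and zero integrals, its second moment is at most
    \<open>1 + \<kappa>\<close>; over \<open>n\<close> observations these become n-th
    powers.\<close>
  define r where "r = (\<lambda>k x. 1 + \<gamma> k x / g x)"
  define Q where "Q = PiM {..<n} (\<lambda>_. M)"
  define \<rho> where "\<rho> = (\<lambda>k X. \<Prod>i\<in>{..<n}. r k (X i))"
  define S where "S = PiM {..<n} (\<lambda>_. borel :: (real ^ 'd) measure)"
  have M: "prob_space M"
    using one by (intro prob_spaceI) (simp add: M_def emeasure_density)
  interpret M: prob_space M by fact
  interpret PM: product_sigma_finite "\<lambda>_. M"
    unfolding product_sigma_finite_def using M by (simp add: prob_space_imp_sigma_finite)
  have Q: "prob_space Q" unfolding Q_def using M by (intro prob_space_PiM)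
  interpret Q: prob_space Q by fact
  have sets_M[measurable_cong]: "sets M = sets borel" by (simp add: M_def)
  have sets_Q: "sets Q = sets S" "space Q = space S"
    unfolding Q_def S_def by (auto intro!: sets_PiM_cong sets_eq_imp_space_eq simp: sets_M)
  have r_meas: "r k \<in> borel_measurable borel" if "k < K" for k
    unfolding r_def using \<gamma>_meas[OF that] by measurable
  have r0: "0 \<le> r k x" if "k < K" for k x
    using nonneg[OF that, of x] pos[of x] by (simp add: r_def add_divide_distrib[symmetric] field_simps)
  have int_M: "integrable M f \<longleftrightarrow> integrable lborel (\<lambda>x. g x * f x)"
    "integral\<^sup>L M f = (\<integral>x. g x * f x \<partial>lborel)" if "f \<in> borel_measurable borel" for f
    unfolding M_def using that pos
    by (auto simp: integrable_density integral_density less_imp_le)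
  have g1: "integrable M (\<lambda>x. \<gamma> k x / g x)" "(\<integral>x. \<gamma> k x / g x \<partial>M) = 0" if k: "k < K" for k
  proof -
    have [measurable]: "\<gamma> k \<in> borel_measurable borel" by (rule \<gamma>_meas[OF k])
    have "g x * (\<gamma> k x / g x) = \<gamma> k x" for x using pos[of x] by simp
    then show "integrable M (\<lambda>x. \<gamma> k x / g x)" "(\<integral>x. \<gamma> k x / g x \<partial>M) = 0"
      using \<gamma>_int[OF k] by (simp_all add: int_M)
  qed
  have g2: "integrable M (\<lambda>x. (\<gamma> k x / g x) * (\<gamma> l x / g x))"
    "(\<integral>x. (\<gamma> k x / g x) * (\<gamma> l x / g x) \<partial>M) \<le> (if k = l then \<kappa> else 0)"
    if k: "k < K" and l: "l < K" for k l
  proof -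
    have [measurable]: "\<gamma> k \<in> borel_measurable borel" "\<gamma> l \<in> borel_measurable borel"
      by (rule \<gamma>_meas[OF k], rule \<gamma>_meas[OF l])
    have "(\<lambda>x. (\<gamma> k x / g x) * (\<gamma> l x / g x)) = (\<lambda>x. 0)" if "k \<noteq> l"
      using disj[OF k l that] by (auto simp: fun_eq_iff)
    moreover have "g x * ((\<gamma> k x / g x) * (\<gamma> k x / g x)) = (\<gamma> k x)\<^sup>2 / g x" for x
      using pos[of x] by (simp add: power2_eq_square)
    ultimately show "integrable M (\<lambda>x. (\<gamma> k x / g x) * (\<gamma> l x / g x))"
      "(\<integral>x. (\<gamma> k x / g x) * (\<gamma> l x / g x) \<partial>M) \<le> (if k = l then \<kappa> else 0)"
      using chi_int[OF k] chi[OF k] by (cases "k = l"; simp add: int_M)+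
  qed
  have r1: "integrable M (r k)" "(\<integral>x. r k x \<partial>M) = 1" if "k < K" for k
    unfolding r_def using g1[OF that] by (auto simp: M.prob_space)
  have rr: "r k x * r l x = (1 + \<gamma> k x / g x + \<gamma> l x / g x) + (\<gamma> k x / g x) * (\<gamma> l x / g x)" for k l x
    unfolding r_def by (simp add: algebra_simps)
  have r2: "integrable M (\<lambda>x. r k x * r l x)"
    "(\<integral>x. r k x * r l x \<partial>M) \<le> (if k = l then 1 + \<kappa> else 1)" if "k < K" "l < K" for k l
    unfolding rr using g1[OF that(1)] g1[OF that(2)] g2[OF that] by (auto simp: M.prob_space split: if_splits)
  \<comment> \<open>Passing to n-th powers preserves the upper bounds on these moments only because
    the moments are nonnegative.\<close>
  have r2': "0 \<le> (\<integral>x. r k x * r l x \<partial>M)" if "k < K" "l < K" for k l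
    using r0 that by (intro integral_nonneg_AE) auto
  have \<rho>1: "integrable Q (\<rho> k)" "(\<integral>X. \<rho> k X \<partial>Q) = 1" if "k < K" for k
    unfolding \<rho>_def Q_def using r1[OF that]
    by (auto simp: PM.product_integral_prod[where f = "\<lambda>_. r k"]
        intro!: PM.product_integrable_prod)
  have \<rho>\<rho>: "\<rho> k X * \<rho> l X = (\<Prod>i\<in>{..<n}. r k (X i) * r l (X i))" for k l X
    unfolding \<rho>_def by (simp add: prod.distrib)
  have \<rho>2: "integrable Q (\<lambda>X. \<rho> k X * \<rho> l X)"
    "(\<integral>X. \<rho> k X * \<rho> l X \<partial>Q) = (\<integral>x. r k x * r l x \<partial>M) ^ n" if "k < K" "l < K" for k l
    unfolding \<rho>\<rho> Q_def using r2[OF that]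
    by (auto simp: PM.product_integral_prod[where f = "\<lambda>i x. r k x * r l x"]
        intro!: PM.product_integrable_prod[where f = "\<lambda>i x. r k x * r l x"])
  have \<rho>0: "0 \<le> \<rho> k X" if "k < K" for k X
    unfolding \<rho>_def using r0[OF that] by (intro prod_nonneg) auto
  have dens: "density M (\<lambda>x. ennreal (r k x)) = density lborel (\<lambda>x. ennreal (g x + \<gamma> k x))" if k: "k < K" for k
  proof -
    have [measurable]: "\<gamma> k \<in> borel_measurable borel" "r k \<in> borel_measurable borel"
      by (rule \<gamma>_meas[OF k], rule r_meas[OF k])
    have "ennreal (g x) * ennreal (r k x) = ennreal (g x + \<gamma> k x)" for x
    proof -
      have "g x * r k x = g x + \<gamma> k x" using pos[of x] by (simp add: r_def distrib_left)
      then show ?thesis using pos[of x] r0[OF k, of x] by (simp add: ennreal_mult[symmetric])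
    qed
    then show ?thesis unfolding M_def by (subst density_density_eq) auto
  qed
  have iid0: "iid_sample n g = Q" by (simp add: iid_sample_def Q_def M_def)
  have iidk: "iid_sample n (\<lambda>x. g x + \<gamma> k x) = density Q (\<lambda>X. ennreal (\<rho> k X))" if k: "k < K" for k
  proof -
    have [measurable]: "r k \<in> borel_measurable borel" by (rule r_meas[OF k])
    have "prob_space (density M (\<lambda>x. ennreal (r k x)))"
      using r1[OF k] r0[OF k] by (intro prob_spaceI)
        (simp add: emeasure_density nn_integral_eq_integral)
    then show ?thesis
      unfolding iid_sample_def dens[OF k, symmetric] Q_def \<rho>_def
      using M r0[OF k] by (intro PiM_density) auto
  qed
  let ?base = "\<lambda>X. linf_norm (\<lambda>x. e X x - g x)"
  let ?l = "\<lambda>k X. linf_norm (\<lambda>x. e X x - (g x + \<gamma> k x))"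
  have eX: "e X \<in> borel_measurable borel" if "X \<in> space S" for X
    using e that by (auto simp: estimators_def S_def)
  have l0: "?base \<in> borel_measurable S"
    using e by (auto simp: estimators_def S_def)
  define T where "T = {X \<in> space S. ?base X < ennreal s}"
  have T: "T \<in> sets Q" unfolding sets_Q T_def using l0 by measurable
  have sepX: "ennreal s \<le> ?l k X" if k: "k < K" and X: "X \<in> T" for k X
  proof (rule ccontr)
    assume *: "\<not> ennreal s \<le> ?l k X"
    have [measurable]: "\<gamma> k \<in> borel_measurable borel" by (rule \<gamma>_meas[OF k])
    have [measurable]: "e X \<in> borel_measurable borel" using X by (intro eX) (auto simp: T_def)
    have "ennreal s + ennreal s \<le> linf_norm (\<gamma> k)" using sep[OF k] s by (simp add: ennreal_plus[symmetric] del: ennreal_plus)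
    also have "\<gamma> k = (\<lambda>x. (g x + \<gamma> k x) - g x)" by auto
    also have "linf_norm \<dots> \<le> ?base X + ?l k X"
      by (rule linf_norm_triangle_diff) auto
    also have "\<dots> < ennreal s + ennreal s"
      using * X by (intro add_strict_mono) (auto simp: T_def)
    finally show False by simp
  qed
  let ?R = "SUP p\<in>P. risk n e p"
  have R0: "ennreal (s * (1 - measure Q T)) \<le> ?R"
  proof -
    have "ennreal (s * (1 - measure Q T)) = ennreal s * emeasure Q (space Q - T)"
      using T s by (simp add: Q.emeasure_eq_measure Q.prob_compl ennreal_mult)
    also have "\<dots> = (\<integral>\<^sup>+X. ennreal s * indicator (space Q - T) X \<partial>Q)"
      using T by (simp add: nn_integral_cmult_indicator)
    also have "\<dots> \<le> (\<integral>\<^sup>+X. ?base X \<partial>Q)"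
      by (intro nn_integral_mono) (auto simp: T_def indicator_def sets_Q)
    also have "\<dots> = risk n e g" by (simp add: risk_def iid0)
    also have "\<dots> \<le> ?R" using g by (intro SUP_upper)
    finally show ?thesis .
  qed
  have Rk: "ennreal (s * (\<integral>X. \<rho> k X * indicator T X \<partial>Q)) \<le> ?R" if k: "k < K" for k
  proof -
    have [measurable]: "\<rho> k \<in> borel_measurable Q" using \<rho>1(1)[OF k] by auto
    have "ennreal (s * (\<integral>X. \<rho> k X * indicator T X \<partial>Q))
        = ennreal s * ennreal (\<integral>X. \<rho> k X * indicator T X \<partial>Q)"
      using s \<rho>0[OF k] by (intro ennreal_mult) (auto intro!: integral_nonneg_AE)
    also have "ennreal (\<integral>X. \<rho> k X * indicator T X \<partial>Q) = (\<integral>\<^sup>+X. ennreal (\<rho> k X * indicator T X) \<partial>Q)"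
      using \<rho>0[OF k] T \<rho>1(1)[OF k]
      by (intro nn_integral_eq_integral[symmetric] integrable_real_mult_indicator) auto
    also have "\<dots> = (\<integral>\<^sup>+X. ennreal (\<rho> k X) * indicator T X \<partial>Q)"
      by (intro nn_integral_cong) (auto simp: indicator_def)
    also have "\<dots> = emeasure (density Q (\<lambda>X. ennreal (\<rho> k X))) T"
      using T by (intro emeasure_density[symmetric]) auto
    also have "ennreal s * \<dots> = (\<integral>\<^sup>+X. ennreal s * indicator T X \<partial>density Q (\<lambda>X. ennreal (\<rho> k X)))"
      using T by (simp add: nn_integral_cmult_indicator)
    also have "\<dots> \<le> (\<integral>\<^sup>+X. ?l k X \<partial>density Q (\<lambda>X. ennreal (\<rho> k X)))"
      using sepX[OF k] by (intro nn_integral_mono) (auto simp: indicator_def)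
    also have "\<dots> = risk n e (\<lambda>x. g x + \<gamma> k x)" by (simp add: risk_def iidk[OF k])
    also have "\<dots> \<le> ?R" using pk[OF k] by (intro SUP_upper)
    finally show ?thesis .
  qed
  have test: "measure Q T \<le> (\<Sum>k<K. \<integral>X. \<rho> k X * indicator T X \<partial>Q) / real K + 1/2"
  proof (rule mixture_testing_bound[OF Q K(1) T \<rho>1 \<rho>2(1)])
    fix k assume k: "k < K"
    have "(\<integral>x. r k x * r k x \<partial>M) ^ n \<le> (1 + \<kappa>) ^ n"
      using r2(2)[OF k k] r2'[OF k k] by (intro power_mono) auto
    then show "(\<integral>x. \<rho> k x * \<rho> k x \<partial>Q) \<le> real K / 4" using K(2) k by (simp add: \<rho>2)
  next
    fix k l assume kl: "k < K" "l < K" "k \<noteq> l"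
    then show "(\<integral>x. \<rho> k x * \<rho> l x \<partial>Q) \<le> 1"
      using r2(2)[OF kl(1,2)] r2'[OF kl(1,2)] by (simp add: \<rho>2 power_le_one)
  qed
  show "ennreal (s / 4) \<le> ?R"
  proof (cases ?R)
    case (real v)
    have 0: "s * (1 - measure Q T) \<le> v"
      using R0 real by (simp add: ennreal_le_iff)
    have k: "s * (\<integral>X. \<rho> k X * indicator T X \<partial>Q) \<le> v" if "k < K" for k
      using Rk[OF that] real by (simp add: ennreal_le_iff)
    have "s * (\<Sum>k<K. \<integral>X. \<rho> k X * indicator T X \<partial>Q) \<le> (\<Sum>k<K. v)"
      unfolding sum_distrib_left using k by (intro sum_mono) auto
    then have 1: "s * ((\<Sum>k<K. \<integral>X. \<rho> k X * indicator T X \<partial>Q) / real K) \<le> v"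
      using K(1) by (simp add: field_simps)
    have "s * (1/2) \<le> s * ((1 - measure Q T) + (\<Sum>k<K. \<integral>X. \<rho> k X * indicator T X \<partial>Q) / real K)"
      using s test by (intro mult_left_mono) linarith+
    also have "\<dots> \<le> 2 * v" using 0 1 by (simp add: distrib_left)
    finally show ?thesis using real by (simp add: ennreal_leI)
  next
    case top
    then show ?thesis by (simp only: top_greatest)
  qed
qed

subsection \<open>Smooth bumps\<close>

text \<open>Finitely many derivatives suffice, so a truncated polynomial takes the place of a smooth
  bump. Smoothness at the endpoints becomes divisibility by a power of \<open>[:1, 0, -1:]\<close>,
  which is 1 - t^2, and differentiation becomes \<open>pderiv\<close>.\<close>

definition bump :: "real poly \<Rightarrow> real \<Rightarrow> real" where
  "bump p t = (if \<bar>t\<bar> \<le> 1 then poly p t else 0)"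

text \<open>By the product rule, each derivative costs one factor \<open>q\<close>.\<close>

lemma dvd_pderiv_funpow:
  fixes q p :: "real poly"
  assumes "q ^ (k + m) dvd p"
  shows "q ^ k dvd (pderiv ^^ m) p"
  using assms
proof (induction m arbitrary: p)
  case (Suc m)
  then obtain r where p: "p = q ^ Suc (k + m) * r" by (auto elim!: dvdE)
  have "pderiv p = q ^ (k + m) * (q * pderiv r + of_nat (Suc (k + m)) * pderiv q * r)"
    unfolding p pderiv_mult pderiv_power_Suc by (simp add: algebra_simps of_nat_poly)
  then have "q ^ (k + m) dvd pderiv p" by simp
  from Suc.IH[OF this] show ?case by (simp add: funpow_swap1)
qed simp

text \<open>The square makes both \<open>p\<close> and its derivative vanish at 1 and -1, so the
  polynomial and the zero function glue to a differentiable function. The derivative is again a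
  truncated polynomial, which allows iteration.\<close>

lemma bump_has_derivative:
  assumes "[:1, 0, -1:] ^ 2 dvd p"
  shows "(bump p has_real_derivative bump (pderiv p) t) (at t)"
proof -
  obtain r where p: "p = [:1, 0, -1:] ^ 2 * r" using assms by (elim dvdE)
  have S: "closure {-1..1::real} = {-1..1}" "closure (- {-1..1::real}) = {..-1} \<union> {1..}"
  proof -
    have "- {-1..1::real} = {..<-1} \<union> {1<..}" by auto
    then show "closure (- {-1..1::real}) = {..-1} \<union> {1..}" by simp
  qed simp
  have z: "poly p x = 0" "poly (pderiv p) x = 0" if "x = 1 \<or> x = -1" for x
  proof -
    have q: "poly [:1, 0, -1:] x = 0" using that by auto
    then show "poly p x = 0" unfolding p poly_mult poly_power q by simp
    have "[:1, 0, -1:] ^ 1 dvd (pderiv ^^ 1) p"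
      by (rule dvd_pderiv_funpow) (use assms in \<open>simp only: one_add_one\<close>)
    then have "[:1, 0, -1:] dvd pderiv p" by simp
    then obtain r' where "pderiv p = [:1, 0, -1:] * r'" by (elim dvdE)
    then show "poly (pderiv p) x = 0" by (simp only: poly_mult q mult_zero_left)
  qed
  have "((\<lambda>x. if x \<in> {-1..1} then poly p x else 0) has_vector_derivative
      (if t \<in> {-1..1} then poly (pderiv p) t else 0)) (at t within ({-1..1} \<union> - {-1..1}))"
  proof (rule has_vector_derivative_If_within_closures[where u = "{-1..1} \<union> - {-1..1}"])
    show "(poly p has_vector_derivative poly (pderiv p) t)
       (at t within {- 1..1} \<union> closure {- 1..1} \<inter> closure (- {- 1..1}))"
      using poly_DERIV[of p t] unfolding has_real_derivative_iff_has_vector_derivative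
      by (rule has_vector_derivative_at_within)
  qed (use z[of 1] z[of "-1"] in \<open>auto simp: S\<close>)
  moreover have "bump q = (\<lambda>x. if x \<in> {-1..1} then poly q x else 0)" for q
    by (auto simp: bump_def fun_eq_iff)
  ultimately show ?thesis
    by (simp add: has_real_derivative_iff_has_vector_derivative)
qed

lemma bump_bounded: "\<exists>B\<ge>0. \<forall>t. \<bar>bump p t\<bar> \<le> B"
proof -
  have "bounded (poly p ` {-1..1})"
    by (intro compact_imp_bounded compact_continuous_image continuous_intros) auto
  then obtain B where "\<forall>t\<in>{-1..1}. \<bar>poly p t\<bar> \<le> B" by (auto simp: bounded_iff)
  then show ?thesis
    by (intro exI[of _ "max B 0"]) (force simp: bump_def le_max_iff_disj)
qed

text \<open>For points at distance at most 1 the Lipschitz bound suffices, because \<bar>s - t\<bar>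
  is then at most its power with exponent \<open>a\<close>; for distant points boundedness suffices,
  because that power is at least 1.\<close>

lemma bump_hoelder:
  assumes "[:1, 0, -1:] ^ 2 dvd p" and a: "0 \<le> a" "a \<le> 1"
  shows "\<exists>H\<ge>0. \<forall>s t. s \<noteq> t \<longrightarrow> \<bar>bump p s - bump p t\<bar> \<le> H * \<bar>s - t\<bar> powr a"
proof -
  obtain B where B: "0 \<le> B" "\<And>t. \<bar>bump p t\<bar> \<le> B" using bump_bounded by blast
  obtain D where D: "0 \<le> D" "\<And>t. \<bar>bump (pderiv p) t\<bar> \<le> D" using bump_bounded by blast
  have "\<bar>bump p s - bump p t\<bar> \<le> (2 * B + D) * \<bar>s - t\<bar> powr a" if "s \<noteq> t" for s t
  proof (cases "\<bar>s - t\<bar> \<le> 1")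
    case True
    have "norm (bump p s - bump p t) \<le> D * norm (s - t)"
      using bump_has_derivative[OF assms(1)] D
      by (intro field_differentiable_bound[of UNIV "bump p" "bump (pderiv p)"]) auto
    moreover have "\<bar>s - t\<bar> powr 1 \<le> \<bar>s - t\<bar> powr a"
      using True a that by (intro powr_mono') auto
    ultimately have "\<bar>bump p s - bump p t\<bar> \<le> D * \<bar>s - t\<bar> powr a"
      using D(1) by (simp, meson mult_left_mono order_trans)
    also have "\<dots> \<le> (2 * B + D) * \<bar>s - t\<bar> powr a"
      using B(1) by (intro mult_right_mono) auto
    finally show ?thesis .
  next
    case False
    have "\<bar>bump p s - bump p t\<bar> \<le> 2 * B" using B(2)[of s] B(2)[of t] by linarith
    also have "\<dots> \<le> (2 * B + D) * 1" using D(1) by simp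
    also have "\<dots> \<le> (2 * B + D) * \<bar>s - t\<bar> powr a"
      using False a B(1) D(1) by (intro mult_left_mono) (auto intro: ge_one_powr_ge_zero)
    finally show ?thesis .
  qed
  then show ?thesis using B(1) D(1) by (intro exI[of _ "2 * B + D"]) auto
qed

section \<open>Products of profiles over the coordinates and their Hoelder seminorms\<close>

definition box_bump ::
  "real poly \<Rightarrow> real \<Rightarrow> real ^ 'd \<Rightarrow> real ^ 'd \<Rightarrow> real ^ 'd \<Rightarrow> real" where
  "box_bump p a w c x = a * (\<Prod>i\<in>UNIV. bump p ((x $ i - c $ i) / w $ i))"

lemma box_bump_split:
  "box_bump p a w c x = a * bump p ((x $ i - c $ i) / w $ i)
    * (\<Prod>j\<in>UNIV-{i}. bump p ((x $ j - c $ j) / w $ j))"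
  unfolding box_bump_def
  by (simp only: prod.remove[OF finite UNIV_I, of _ i] mult.assoc)

text \<open>The pure partial derivative of order \<open>k\<close> in direction \<open>i\<close>:
  only the i-th factor is differentiated, and the chain rule contributes the power of
  \<open>w $ i\<close>.\<close>

definition box_bump_deriv ::
  "'d \<Rightarrow> nat \<Rightarrow> real poly \<Rightarrow> real \<Rightarrow> real ^ 'd \<Rightarrow> real ^ 'd \<Rightarrow> real ^ 'd \<Rightarrow> real" where
  "box_bump_deriv i k p a w c x = a / (w $ i) ^ k
    * bump ((pderiv ^^ k) p) ((x $ i - c $ i) / w $ i)
    * (\<Prod>j\<in>UNIV-{i}. bump p ((x $ j - c $ j) / w $ j))"

lemma box_bump_deriv_along_axis:
  fixes w c :: "real ^ 'd"
  assumes p: "[:1, 0, -1:] ^ (k + 2) dvd p" and w: "w $ i \<noteq> 0"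
  shows "((\<lambda>t. box_bump_deriv i k p a w c (x + t *\<^sub>R axis i 1))
    has_real_derivative box_bump_deriv i (Suc k) p a w c x) (at 0)"
proof -
  have q: "[:1, 0, -1:] ^ 2 dvd (pderiv ^^ k) p"
    using p by (intro dvd_pderiv_funpow) (simp add: add.commute)
  have eq: "(\<lambda>t. box_bump_deriv i k p a w c (x + t *\<^sub>R axis i 1))
      = (\<lambda>t. a / (w $ i) ^ k * bump ((pderiv ^^ k) p) ((x $ i + t - c $ i) / w $ i)
        * (\<Prod>j\<in>UNIV-{i}. bump p ((x $ j - c $ j) / w $ j)))"
    by (auto simp: box_bump_deriv_def axis_def fun_eq_iff intro!: prod.cong)
  have "((\<lambda>t. bump ((pderiv ^^ k) p) ((x $ i + t - c $ i) / w $ i)) has_real_derivative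
      bump (pderiv ((pderiv ^^ k) p)) ((x $ i + 0 - c $ i) / w $ i) * (1 / w $ i)) (at 0)"
    by (rule DERIV_chain2[OF bump_has_derivative[OF q]])
      (auto intro!: derivative_eq_intros simp: w)
  from DERIV_cmult_right[OF DERIV_cmult[OF this]] show ?thesis
    unfolding eq by (rule DERIV_cong) (simp add: box_bump_deriv_def)
qed

text \<open>One factor fewer than in \<open>box_bump_deriv_along_axis\<close>, since reaching order
  \<open>k\<close> only uses differentiability at orders below \<open>k\<close>.\<close>

lemma partial_deriv_box_bump:
  fixes w c :: "real ^ 'd"
  assumes p: "[:1, 0, -1:] ^ (k + 1) dvd p" and w: "w $ i \<noteq> 0"
  shows "(partial_deriv i ^^ k) (box_bump p a w c) = box_bump_deriv i k p a w c"
  using p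
proof (induction k)
  case 0
  show ?case using box_bump_split[of p a w c _ i] by (simp add: fun_eq_iff box_bump_deriv_def)
next
  case (Suc k)
  have "[:1, 0, -1:] ^ (k + 1) dvd p" using Suc.prems by (rule power_le_dvd) simp
  then have "(partial_deriv i ^^ Suc k) (box_bump p a w c) = partial_deriv i (box_bump_deriv i k p a w c)"
    using Suc.IH by simp
  also have "\<dots> = box_bump_deriv i (Suc k) p a w c"
    unfolding partial_deriv_def
    using box_bump_deriv_along_axis[OF _ w, of k] Suc.prems by (auto intro!: ext DERIV_imp_deriv)
  finally show ?case .
qed

lemma has_partial_derivs_box_bump:
  assumes "[:1, 0, -1:] ^ (m + 2) dvd p" "w $ i \<noteq> 0"
  shows "has_partial_derivs i m (box_bump p a w c)"
  unfolding has_partial_derivs_def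
proof (intro allI impI)
  fix k x assume k: "k < m"
  have "[:1, 0, -1:] ^ (k + 2) dvd p" "[:1, 0, -1:] ^ (k + 1) dvd p"
    using k by (intro power_le_dvd[OF assms(1)]; simp)+
  from box_bump_deriv_along_axis[OF this(1) assms(2)]
  show "(\<lambda>t. (partial_deriv i ^^ k) (box_bump p a w c) (x + t *\<^sub>R axis i 1)) differentiable at 0"
    unfolding partial_deriv_box_bump[OF \<open>[:1, 0, -1:] ^ (k + 1) dvd p\<close> assms(2)]
      real_differentiable_def by (rule exI)
qed

text \<open>Rescaling gives \<open>w $ i\<close> to the power -\<lfloor>\<beta>\<rfloor> from the
  derivatives and to the power -(\<beta> - \<lfloor>\<beta>\<rfloor>) from the Hoelder quotient, in
  total -\<beta>. Each of the d - 1 undifferentiated factors is bounded by \<open>B\<close>.\<close>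

lemma holder_seminorm_box_bump:
  fixes w c :: "real ^ 'd"
  assumes p: "[:1, 0, -1:] ^ (nat \<lfloor>\<beta>\<rfloor> + 1) dvd p" and w: "0 < w $ i" and "0 < \<beta>" "0 \<le> a"
    and B: "\<And>t. \<bar>bump p t\<bar> \<le> B"
    and H: "\<And>s t. s \<noteq> t \<Longrightarrow> \<bar>bump ((pderiv ^^ nat \<lfloor>\<beta>\<rfloor>) p) s - bump ((pderiv ^^ nat \<lfloor>\<beta>\<rfloor>) p) t\<bar>
        \<le> H * \<bar>s - t\<bar> powr (\<beta> - of_int \<lfloor>\<beta>\<rfloor>)"
  shows "holder_seminorm i \<beta> (box_bump p a w c)
    \<le> ennreal (a * B ^ (CARD('d) - 1) * H / w $ i powr \<beta>)"
  unfolding holder_seminorm_def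
proof (intro SUP_least ennreal_leI)
  fix x :: "real ^ 'd" and t :: real assume t: "t \<in> - {0}"
  define m where "m = nat \<lfloor>\<beta>\<rfloor>"
  define \<alpha> where "\<alpha> = \<beta> - of_int \<lfloor>\<beta>\<rfloor>"
  have m\<alpha>: "\<beta> = real m + \<alpha>" unfolding m_def \<alpha>_def using \<open>0 < \<beta>\<close> by simp
  define P where "P = (\<Prod>j\<in>UNIV-{i}. bump p ((x $ j - c $ j) / w $ j))"
  have P: "\<bar>P\<bar> \<le> B ^ (CARD('d) - 1)"
  proof -
    have "\<bar>P\<bar> \<le> (\<Prod>j\<in>UNIV-{i}. B)"
      unfolding P_def abs_prod using B by (intro prod_mono) auto
    then show ?thesis by (simp add: card_Diff_singleton)
  qed
  \<comment> \<open>The nonnegativity of \<open>H\<close> is read off from its own Hoelder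
    inequality at the points 1 and 0.\<close>
  have "0 \<le> H * \<bar>1 - 0\<bar> powr (\<beta> - of_int \<lfloor>\<beta>\<rfloor>)"
    by (rule order_trans[OF abs_ge_zero H]) simp
  then have H0: "0 \<le> H" by simp
  let ?u = "\<lambda>s. (x $ i + s - c $ i) / w $ i"
  have D: "(partial_deriv i ^^ m) (box_bump p a w c) (x + s *\<^sub>R axis i 1)
      = a / w $ i ^ m * bump ((pderiv ^^ m) p) (?u s) * P" for s
    unfolding P_def using p w
    by (subst partial_deriv_box_bump) (auto simp: m_def axis_def box_bump_deriv_def intro!: prod.cong)
  have du: "?u t - ?u 0 = t / w $ i" by (simp add: diff_divide_distrib add_divide_distrib)
  have "\<bar>(partial_deriv i ^^ m) (box_bump p a w c) (x + t *\<^sub>R axis i 1) - (partial_deriv i ^^ m) (box_bump p a w c) x\<bar>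
      = \<bar>a / w $ i ^ m * (bump ((pderiv ^^ m) p) (?u t) - bump ((pderiv ^^ m) p) (?u 0)) * P\<bar>"
    using D[of t] D[of 0] by (simp add: algebra_simps)
  also have "\<dots> = a / w $ i ^ m * \<bar>bump ((pderiv ^^ m) p) (?u t) - bump ((pderiv ^^ m) p) (?u 0)\<bar> * \<bar>P\<bar>"
    using w \<open>0 \<le> a\<close> by (simp add: abs_mult)
  also have "\<dots> \<le> a / w $ i ^ m * (H * \<bar>?u t - ?u 0\<bar> powr \<alpha>) * B ^ (CARD('d) - 1)"
    using w \<open>0 \<le> a\<close> t P H[of "?u t" "?u 0"] H0 unfolding m_def[symmetric] \<alpha>_def[symmetric]
    by (intro mult_mono) auto
  also have "\<dots> = \<bar>t\<bar> powr \<alpha> * (a * B ^ (CARD('d) - 1) * H / w $ i powr \<beta>)"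
    using w by (simp add: du m\<alpha> powr_add powr_realpow powr_divide abs_divide field_simps)
  finally show "1 / \<bar>t\<bar> powr (\<beta> - of_int \<lfloor>\<beta>\<rfloor>) *
      \<bar>(partial_deriv i ^^ nat \<lfloor>\<beta>\<rfloor>) (box_bump p a w c) (x + t *\<^sub>R axis i 1)
       - (partial_deriv i ^^ nat \<lfloor>\<beta>\<rfloor>) (box_bump p a w c) x\<bar>
      \<le> a * B ^ (CARD('d) - 1) * H / w $ i powr \<beta>"
    using t unfolding m_def[symmetric] \<alpha>_def[symmetric] by (simp add: field_simps)
qed

section \<open>Sums of functions with pure partial derivatives\<close>

lemma partial_deriv_add:
  assumes "has_partial_derivs i m f" "has_partial_derivs i m g" "k \<le> m"
  shows "(partial_deriv i ^^ k) (\<lambda>x. f x + g x)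
    = (\<lambda>x. (partial_deriv i ^^ k) f x + (partial_deriv i ^^ k) g x)"
  using \<open>k \<le> m\<close>
proof (induction k)
  case (Suc k)
  let ?F = "(partial_deriv i ^^ k) f" and ?G = "(partial_deriv i ^^ k) g"
  have d: "(\<lambda>t. ?F (x + t *\<^sub>R axis i 1)) field_differentiable at 0"
     "(\<lambda>t. ?G (x + t *\<^sub>R axis i 1)) field_differentiable at 0" for x
    using assms(1,2) Suc.prems
    by (auto simp: has_partial_derivs_def field_differentiable_def real_differentiable_def)
  have "(partial_deriv i ^^ Suc k) (\<lambda>x. f x + g x) = partial_deriv i (\<lambda>x. ?F x + ?G x)"
    using Suc by simp
  also have "\<dots> = (\<lambda>x. partial_deriv i ?F x + partial_deriv i ?G x)"
    unfolding partial_deriv_def[of i "\<lambda>x. _ x + _ x"] partial_deriv_def[of i ?F]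
      partial_deriv_def[of i ?G] by (intro ext deriv_add d)
  finally show ?case by simp
qed simp

lemma has_partial_derivs_add:
  assumes "has_partial_derivs i m f" "has_partial_derivs i m g"
  shows "has_partial_derivs i m (\<lambda>x. f x + g x)"
  using assms unfolding has_partial_derivs_def
  by (auto simp: partial_deriv_add[OF assms] intro!: differentiable_add)

lemma holder_seminorm_add:
  assumes "has_partial_derivs i (nat \<lfloor>\<beta>\<rfloor>) f" "has_partial_derivs i (nat \<lfloor>\<beta>\<rfloor>) g"
  shows "holder_seminorm i \<beta> (\<lambda>x. f x + g x) \<le> holder_seminorm i \<beta> f + holder_seminorm i \<beta> g"
  unfolding holder_seminorm_def[of i \<beta> "\<lambda>x. f x + g x"]
proof (intro SUP_least)
  fix x and t :: real assume t: "t \<in> - {0}"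
  let ?q = "\<lambda>f. 1 / \<bar>t\<bar> powr (\<beta> - of_int \<lfloor>\<beta>\<rfloor>) *
      \<bar>(partial_deriv i ^^ nat \<lfloor>\<beta>\<rfloor>) f (x + t *\<^sub>R axis i 1) - (partial_deriv i ^^ nat \<lfloor>\<beta>\<rfloor>) f x\<bar>"
  have le: "ennreal (?q f) \<le> holder_seminorm i \<beta> f" for f
    unfolding holder_seminorm_def using t by (intro SUP_upper2[of x] SUP_upper2[of t]) auto
  have "?q (\<lambda>x. f x + g x) \<le> ?q f + ?q g"
    unfolding partial_deriv_add[OF assms order_refl] distrib_left[symmetric]
    by (intro mult_left_mono; simp?; linarith)
  then have "ennreal (?q (\<lambda>x. f x + g x)) \<le> ennreal (?q f + ?q g)" by (rule ennreal_leI)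
  also have "\<dots> = ennreal (?q f) + ennreal (?q g)" by (intro ennreal_plus) auto
  also have "\<dots> \<le> holder_seminorm i \<beta> f + holder_seminorm i \<beta> g" by (intro add_mono le)
  finally show "ennreal (?q (\<lambda>x. f x + g x)) \<le> holder_seminorm i \<beta> f + holder_seminorm i \<beta> g" .
qed

section \<open>Size, support and integrals of product bumps\<close>

lemma continuous_on_box_bump:
  assumes "[:1, 0, -1:] ^ 2 dvd p"
  shows "continuous_on UNIV (box_bump p a w c)"
proof -
  have "continuous_on UNIV (bump p)"
    using bump_has_derivative[OF assms] by (rule DERIV_continuous_on)
  then have "continuous_on UNIV (\<lambda>x. bump p ((x $ i - c $ i) / w $ i))" for i
    by (rule continuous_on_compose2) (auto simp: divide_inverse intro!: continuous_intros)
  then show ?thesis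
    unfolding box_bump_def[abs_def] by (intro continuous_on_mult continuous_on_prod continuous_on_const)
qed

lemma borel_measurable_box_bump:
  assumes "[:1, 0, -1:] ^ 2 dvd p"
  shows "box_bump p a w c \<in> borel_measurable borel"
  by (intro borel_measurable_continuous_onI continuous_on_box_bump assms)

lemma abs_box_bump_le:
  fixes w c :: "real ^ 'd"
  assumes "0 \<le> a" "\<And>t. \<bar>bump p t\<bar> \<le> B"
  shows "\<bar>box_bump p a w c x\<bar> \<le> a * B ^ CARD('d)"
proof -
  have "(\<Prod>i\<in>UNIV. \<bar>bump p ((x $ i - c $ i) / w $ i)\<bar>) \<le> (\<Prod>i\<in>(UNIV::'d set). B)"
    using assms(2) by (intro prod_mono) auto
  then show ?thesis
    using assms(1) unfolding box_bump_def abs_mult abs_prod by (intro mult_mono) (auto intro: prod_nonneg)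
qed

lemma box_bump_support:
  assumes "\<And>i. 0 < w $ i" "box_bump p a w c x \<noteq> 0"
  shows "\<bar>x $ i - c $ i\<bar> \<le> w $ i"
proof (rule ccontr)
  assume "\<not> ?thesis"
  then have "\<not> \<bar>(x $ i - c $ i) / w $ i\<bar> \<le> 1" using assms(1)[of i] by (simp add: abs_divide)
  then have "bump p ((x $ i - c $ i) / w $ i) = 0" by (simp only: bump_def if_False)
  then show False using assms(2) by (auto simp: box_bump_def)
qed

text \<open>The strict inequality is what makes bumps on boxes with a common face disjoint.\<close>

lemma box_bump_support_strict:
  assumes "\<And>i. 0 < w $ i" "box_bump p a w c x \<noteq> 0" "poly p 1 = 0" "poly p (-1) = 0"
  shows "\<bar>x $ i - c $ i\<bar> < w $ i"
proof (rule ccontr)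
  assume *: "\<not> ?thesis"
  with box_bump_support[OF assms(1,2), of i] have "\<bar>x $ i - c $ i\<bar> = w $ i" by simp
  then have "(x $ i - c $ i) / w $ i = 1 \<or> (x $ i - c $ i) / w $ i = -1"
    using assms(1)[of i] by (auto simp: abs_if divide_eq_eq split: if_splits)
  then have "bump p ((x $ i - c $ i) / w $ i) = 0" using assms(3,4) by (auto simp: bump_def)
  then show False using assms(2) by (auto simp: box_bump_def)
qed

lemma measure_lborel_box_cart:
  fixes w c :: "real ^ 'd"
  assumes "\<And>i. 0 \<le> w $ i"
  shows "measure lborel (cbox (c - w) (c + w)) = (\<Prod>i\<in>UNIV. 2 * w $ i)"
proof -
  have "c \<in> cbox (c - w) (c + w)" using assms by (auto simp: mem_box_cart)
  then show ?thesis by (subst content_cbox_cart) auto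
qed

text \<open>The chi-square integrand vanishes outside the box; inside it is at most the squared
  amplitude over the lower bound \<open>m\<close> of the density, and the box has side lengths
  \<open>2 * w $ i\<close>.\<close>

lemma box_bump_integrals:
  fixes w c :: "real ^ 'd"
  assumes p: "[:1, 0, -1:] ^ 2 dvd p" and w: "\<And>i. 0 < w $ i" and a: "0 \<le> a"
    and B: "\<And>t. \<bar>bump p t\<bar> \<le> B"
    and [measurable]: "p0 \<in> borel_measurable borel" and p0: "\<And>x. 0 < p0 x" and "0 < m"
    and m: "\<And>x. (\<And>i. \<bar>x $ i - c $ i\<bar> \<le> w $ i) \<Longrightarrow> m \<le> p0 x"
  shows "integrable lborel (box_bump p a w c)"
    and "integrable lborel (\<lambda>x. (box_bump p a w c x)\<^sup>2 / p0 x)"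
    and "(\<integral>x. (box_bump p a w c x)\<^sup>2 / p0 x \<partial>lborel)
      \<le> (a * B ^ CARD('d))\<^sup>2 / m * (\<Prod>i\<in>UNIV. 2 * w $ i)"
proof -
  note [measurable] = borel_measurable_box_bump[OF p]
  let ?C = "cbox (c - w) (c + w)" and ?F = "a * B ^ CARD('d)" and ?g = "box_bump p a w c"
  have fin: "integrable lborel (\<lambda>x. k * indicator ?C x :: real)" for k
    by (intro integrable_mult_right integrable_real_indicator) (use emeasure_lborel_cbox_finite[of "c - w" "c + w"] in \<open>auto simp: infinity_ennreal_def\<close>)
  have out: "?g x = 0" if "x \<notin> ?C" for x
  proof (rule ccontr)
    assume "?g x \<noteq> 0"
    from box_bump_support[OF w this] have "c $ i - w $ i \<le> x $ i \<and> x $ i \<le> c $ i + w $ i" for i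
      by (simp add: abs_le_iff) (smt (verit))
    then show False using that by (simp add: mem_box_cart)
  qed
  have g: "\<bar>?g x\<bar> \<le> ?F" for x by (rule abs_box_bump_le[OF a B])
  show "integrable lborel ?g"
    by (rule Bochner_Integration.integrable_bound[OF fin[of ?F]])
      (use g out in \<open>auto simp: indicator_def intro!: AE_I2 order_trans[OF g abs_ge_self]\<close>)
  have le: "(?g x)\<^sup>2 / p0 x \<le> ?F\<^sup>2 / m * indicator ?C x" for x
  proof (cases "x \<in> ?C")
    case True
    then have "m \<le> p0 x" by (intro m) (auto simp: mem_box_cart abs_le_iff algebra_simps)
    moreover have "(?g x)\<^sup>2 \<le> ?F\<^sup>2" using power_mono[OF g[of x], of 2] by simp
    ultimately show ?thesis using True \<open>0 < m\<close> by (auto intro!: frac_le)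
  qed (simp add: out)
  have nn: "0 \<le> (?g x)\<^sup>2 / p0 x" for x using p0[of x] by simp
  show i: "integrable lborel (\<lambda>x. (?g x)\<^sup>2 / p0 x)"
    by (rule Bochner_Integration.integrable_bound[OF fin[of "?F\<^sup>2 / m"]])
      (use nn le p0 \<open>0 < m\<close> in \<open>auto simp: less_imp_le intro!: AE_I2\<close>)
  have "(\<integral>x. (?g x)\<^sup>2 / p0 x \<partial>lborel) \<le> (\<integral>x. ?F\<^sup>2 / m * indicator ?C x \<partial>lborel)"
    by (intro integral_mono i fin le)
  also have "\<dots> = ?F\<^sup>2 / m * (\<Prod>i\<in>UNIV. 2 * w $ i)"
    using w measure_lborel_box_cart[of w c] by (simp add: less_imp_le)
  finally show "(\<integral>x. (?g x)\<^sup>2 / p0 x \<partial>lborel) \<le> ?F\<^sup>2 / m * (\<Prod>i\<in>UNIV. 2 * w $ i)" .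
qed

text \<open>Reflection of a single coordinate about \<open>c\<close> changes the sign.\<close>

lemma integral_box_bump_odd:
  fixes w c :: "real ^ 'd"
  assumes p: "[:1, 0, -1:] ^ 2 dvd p" and odd: "\<And>t. poly p (- t) = - poly p t"
  shows "(\<integral>x. box_bump p a w c x \<partial>lborel) = 0"
proof -
  note [measurable] = borel_measurable_box_bump[OF p]
  \<comment> \<open>Any coordinate will do; it exists because types are inhabited.\<close>
  obtain i :: 'd where True by simp
  define e where "e = (axis i 1 :: real ^ 'd)"
  define s where "s = (\<lambda>b. if b = e then -1 else 1 :: real)"
  \<comment> \<open>The reflection is written as a diagonal affine map, for which the change of
    variables in \<open>lborel\<close> has the product of the \<bar>s b\<bar> as its Jacobian, here
    1.\<close>
  define T where "T = (\<lambda>x. (2 * c $ i) *\<^sub>R e + (\<Sum>b\<in>Basis. (s b * (x \<bullet> b)) *\<^sub>R b))"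
  let ?g = "box_bump p a w c"
  have e: "e \<in> Basis" by (simp add: e_def)
  have lb: "lborel = density (distr lborel borel T) (\<lambda>_. ennreal (\<Prod>b\<in>Basis. \<bar>s b\<bar>))"
    unfolding T_def by (rule lborel_affine_euclidean) (auto simp: s_def)
  moreover have "(\<Prod>b\<in>(Basis :: (real ^ 'd) set). \<bar>s b\<bar>) = 1" by (auto simp: s_def intro!: prod.neutral)
  ultimately have lb: "lborel = distr lborel borel T" by (simp add: density_1)
  have T[measurable]: "T \<in> borel_measurable borel" unfolding T_def by measurable
  have Tx: "T x = x + (2 * (c $ i - x $ i)) *\<^sub>R e" for x
  proof -
    have "(\<Sum>b\<in>Basis. (s b * (x \<bullet> b)) *\<^sub>R b) = (\<Sum>b\<in>Basis. (x \<bullet> b) *\<^sub>R b - (if b = e then (2 * (x \<bullet> b)) *\<^sub>R b else 0))"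
      by (intro sum.cong) (auto simp: s_def scaleR_left_distrib[symmetric] scaleR_left_diff_distrib[symmetric])
    also have "\<dots> = x - (2 * (x \<bullet> e)) *\<^sub>R e"
      using e by (simp add: sum_subtractf euclidean_representation sum.delta)
    finally show ?thesis
      by (simp add: T_def e_def cart_eq_inner_axis[symmetric] algebra_simps)
  qed
  have "bump p (- t) = - bump p t" for t by (simp add: bump_def odd)
  moreover have "(T x $ i - c $ i) / w $ i = - ((x $ i - c $ i) / w $ i)" for x
    by (simp add: Tx e_def minus_divide_left)
  moreover have "T x $ j = x $ j" if "j \<noteq> i" for x j
    using that by (simp add: Tx e_def axis_def)
  ultimately have gT: "?g (T x) = - ?g x" for x
    unfolding box_bump_split[of p a w c _ i]
    using prod.cong[OF refl, of "UNIV - {i}" "\<lambda>j. bump p ((T x $ j - c $ j) / w $ j)"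
        "\<lambda>j. bump p ((x $ j - c $ j) / w $ j)"] by simp
  have "(\<integral>x. ?g x \<partial>lborel) = (\<integral>x. ?g x \<partial>distr lborel borel T)" using lb by simp
  also have "\<dots> = (\<integral>x. ?g (T x) \<partial>lborel)" by (intro integral_distr) auto
  also have "\<dots> = - (\<integral>x. ?g x \<partial>lborel)" by (simp add: gT)
  finally show ?thesis by simp
qed

subsection \<open>The Gaussian\<close>

lemma gaussian_pos: "0 < \<sigma> \<Longrightarrow> 0 < gaussian \<sigma> x"
  by (auto simp: gaussian_def intro!: prod_pos normal_density_pos)

lemma continuous_on_gaussian: "0 < \<sigma> \<Longrightarrow> continuous_on UNIV (gaussian \<sigma>)"
  unfolding gaussian_def[abs_def] normal_density_def by (intro continuous_intros) auto

lemma nn_integral_gaussian: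
  assumes "0 < \<sigma>"
  shows "(\<integral>\<^sup>+x. ennreal (gaussian \<sigma> (x :: real ^ 'd)) \<partial>lborel) = 1"
proof -
  have B: "(Basis :: (real ^ 'd) set) = (\<lambda>i. axis i 1) ` UNIV"
    by (auto simp: Basis_vec_def)
  have inj: "inj (\<lambda>i :: 'd. axis i (1::real))" by (auto simp: inj_on_def axis_eq_axis)
  have "ennreal (gaussian \<sigma> x) = (\<Prod>b\<in>Basis. ennreal (normal_density 0 \<sigma> (x \<bullet> b)))" for x :: "real ^ 'd"
    unfolding gaussian_def B prod.reindex[OF inj]
    by (simp add: prod_ennreal cart_eq_inner_axis)
  moreover have "(\<integral>\<^sup>+x. ennreal (normal_density 0 \<sigma> x) \<partial>lborel) = 1"
    using integrable_normal_density[OF assms, of 0] integral_normal_density[OF assms, of 0]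
    by (simp add: nn_integral_eq_integral)
  ultimately show ?thesis
    using nn_integral_lborel_prod[where 'a = "real ^ 'd" and f = "\<lambda>_ x. ennreal (normal_density 0 \<sigma> x)"] by simp
qed

lemma gaussian_half_peak:
  assumes "0 < \<sigma>"
  obtains x :: "real ^ 'd" where "gaussian \<sigma> x = gaussian \<sigma> (0 :: real ^ 'd) / 2"
proof -
  let ?d = "real CARD('d)"
  \<comment> \<open>Moving by \<open>t\<close> in each of the d coordinates multiplies the density
    by exp (- d t^2 / (2 \<sigma>^2)), which is 1/2 for this \<open>t\<close>.\<close>
  define t where "t = \<sigma> * sqrt (2 * ln 2 / ?d)"
  have "t\<^sup>2 / (2 * \<sigma>\<^sup>2) = ln 2 / ?d"
    using assms by (simp add: t_def power_mult_distrib)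
  then have "exp (- (t\<^sup>2 / (2 * \<sigma>\<^sup>2))) ^ CARD('d) = exp (?d * (- (ln 2 / ?d)))"
    by (simp only: exp_of_nat_mult)
  also have "\<dots> = 1 / 2" by (simp add: exp_minus)
  finally have half: "exp (- (t\<^sup>2 / (2 * \<sigma>\<^sup>2))) ^ CARD('d) = 1 / 2" .
  have "gaussian \<sigma> (\<chi> i. t :: real ^ 'd) = gaussian \<sigma> (0 :: real ^ 'd) / 2"
    by (simp add: half gaussian_def normal_density_def power_mult_distrib power_divide)
  then show thesis by (rule that)
qed

lemma gaussian_with_peak_props:
  assumes "0 < b"
  defines "g \<equiv> gaussian_with_peak b :: real ^ 'd \<Rightarrow> real"
  shows "0 < g x" "continuous_on UNIV g" "(\<integral>\<^sup>+x. ennreal (g x) \<partial>lborel) = 1" "g x \<le> b"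
    and "\<exists>x0. g x0 = b / 2"
proof -
  define \<sigma> where "\<sigma> = 1 / (sqrt (2 * pi) * root CARD('d) b)"
  have \<sigma>: "0 < \<sigma>" using assms by (simp add: \<sigma>_def)
  have g: "g = gaussian \<sigma>" unfolding g_def \<sigma>_def by (rule gaussian_with_peak_eq(1)[OF assms(1)])
  show pos: "0 < g x" for x unfolding g by (rule gaussian_pos[OF \<sigma>])
  show cont: "continuous_on UNIV g" unfolding g by (rule continuous_on_gaussian[OF \<sigma>])
  show "(\<integral>\<^sup>+x. ennreal (g x) \<partial>lborel) = 1" unfolding g by (rule nn_integral_gaussian[OF \<sigma>])
  show "g x \<le> b"
    using linf_norm_ge_at[OF cont, of x] gaussian_with_peak_eq(2)[OF assms(1), where 'd='d] assms(1) pos[of x]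
    by (simp add: g_def[symmetric])
  have "g 0 = (1 / sqrt (2 * pi * \<sigma>\<^sup>2)) ^ CARD('d)"
    by (simp add: g gaussian_def normal_density_def)
  then have "ennreal (g 0) = linf_norm g" by (simp add: g linf_norm_gaussian[OF \<sigma>])
  then have "g 0 = b"
    using gaussian_with_peak_eq(2)[OF assms(1), where 'd='d] assms(1) pos[of 0]
    by (simp add: g_def[symmetric])
  moreover obtain x0 :: "real ^ 'd" where "g x0 = g 0 / 2"
    unfolding g by (rule gaussian_half_peak[OF \<sigma>])
  ultimately show "\<exists>x0. g x0 = b / 2" by auto
qed

lemma continuous_cube_neighbourhood:
  fixes g :: "real ^ 'd \<Rightarrow> real"
  assumes "continuous_on UNIV g" "0 < \<epsilon>"
  shows "\<exists>\<delta>>0. \<forall>x. (\<forall>i. \<bar>x $ i - x0 $ i\<bar> \<le> \<delta>) \<longrightarrow> \<bar>g x - g x0\<bar> \<le> \<epsilon>"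
proof -
  from assms obtain \<eta> where \<eta>: "0 < \<eta>" "\<And>x. dist x x0 < \<eta> \<Longrightarrow> dist (g x) (g x0) < \<epsilon>"
    unfolding continuous_on_iff by (metis UNIV_I)
  let ?\<delta> = "\<eta> / (2 * real CARD('d))"
  have "\<bar>g x - g x0\<bar> \<le> \<epsilon>" if "\<And>i. \<bar>x $ i - x0 $ i\<bar> \<le> ?\<delta>" for x
  proof -
    have "dist x x0 \<le> (\<Sum>i\<in>UNIV. \<bar>(x - x0) $ i\<bar>)" unfolding dist_norm by (rule norm_le_l1_cart)
    also have "\<dots> \<le> (\<Sum>i\<in>(UNIV :: 'd set). ?\<delta>)" using that by (intro sum_mono) simp
    also have "\<dots> < \<eta>" using \<eta>(1) by simp
    finally show ?thesis using \<eta>(2) by (simp add: dist_real_def less_imp_le)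
  qed
  moreover have "0 < ?\<delta>" using \<eta>(1) by simp
  ultimately show ?thesis by blast
qed

subsection \<open>Perturbed Gaussians\<close>

text \<open>The profile t * (1 - t^2)^N serves all directions at once. The factor t makes it odd,
  hence of integral zero; as it then vanishes at 0, its height is measured at 1/2.\<close>

lemma bump_profile:
  fixes \<beta> :: "real ^ 'd"
  assumes "\<forall>j. 0 < \<beta> $ j"
  obtains p F H where
    "\<And>i. [:1, 0, -1:] ^ (nat \<lfloor>\<beta> $ i\<rfloor> + 2) dvd p" "\<And>t. poly p (- t) = - poly p t"
    "0 < F" "0 \<le> H" "\<And>t. \<bar>bump p t\<bar> \<le> F" "0 < bump p (1/2)"
    "\<And>i s t. s \<noteq> t \<Longrightarrow>
      \<bar>bump ((pderiv ^^ nat \<lfloor>\<beta> $ i\<rfloor>) p) s - bump ((pderiv ^^ nat \<lfloor>\<beta> $ i\<rfloor>) p) t\<bar>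
      \<le> H * \<bar>s - t\<bar> powr (\<beta> $ i - of_int \<lfloor>\<beta> $ i\<rfloor>)"
proof -
  let ?q = "[:1, 0, -1:] :: real poly"
  \<comment> \<open>The sum dominates every \<lfloor>\<beta>_i\<rfloor>, and the 2 leaves a square
    of 1 - t^2 after that many derivatives, as \<open>bump_hoelder\<close> requires.\<close>
  define N where "N = (\<Sum>i\<in>UNIV. nat \<lfloor>\<beta> $ i\<rfloor>) + 2"
  define p where "p = [:0, 1:] * ?q ^ N"
  have dvd: "?q ^ (nat \<lfloor>\<beta> $ i\<rfloor> + 2) dvd p" for i
  proof -
    have "nat \<lfloor>\<beta> $ i\<rfloor> \<le> (\<Sum>i\<in>UNIV. nat \<lfloor>\<beta> $ i\<rfloor>)" by (intro member_le_sum) auto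
    then show ?thesis unfolding p_def N_def by (intro dvd_mult le_imp_power_dvd) simp
  qed
  have poly_p: "poly p t = t * (1 - t\<^sup>2) ^ N" for t
  proof -
    have "poly ?q t = 1 - t\<^sup>2" by (simp add: power2_eq_square)
    moreover have "poly [:0, 1:] t = t" by simp
    ultimately show ?thesis unfolding p_def poly_mult poly_power by simp
  qed
  obtain B where B: "0 \<le> B" "\<And>t. \<bar>bump p t\<bar> \<le> B" using bump_bounded by blast
  have "\<exists>H\<ge>0. \<forall>s t. s \<noteq> t \<longrightarrow>
      \<bar>bump ((pderiv ^^ nat \<lfloor>\<beta> $ i\<rfloor>) p) s - bump ((pderiv ^^ nat \<lfloor>\<beta> $ i\<rfloor>) p) t\<bar>
      \<le> H * \<bar>s - t\<bar> powr (\<beta> $ i - of_int \<lfloor>\<beta> $ i\<rfloor>)" for i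
  proof (rule bump_hoelder)
    show "?q ^ 2 dvd (pderiv ^^ nat \<lfloor>\<beta> $ i\<rfloor>) p"
      using dvd[of i] by (intro dvd_pderiv_funpow) (simp only: add.commute)
    show "\<beta> $ i - of_int \<lfloor>\<beta> $ i\<rfloor> \<le> 1" by linarith
  qed simp
  then obtain H where H: "\<And>i. 0 \<le> H i" "\<And>i s t. s \<noteq> t \<Longrightarrow>
      \<bar>bump ((pderiv ^^ nat \<lfloor>\<beta> $ i\<rfloor>) p) s - bump ((pderiv ^^ nat \<lfloor>\<beta> $ i\<rfloor>) p) t\<bar>
      \<le> H i * \<bar>s - t\<bar> powr (\<beta> $ i - of_int \<lfloor>\<beta> $ i\<rfloor>)" by metis
  show thesis
  \<comment> \<open>\<open>B + 1\<close> is strictly positive, as a later division by a power of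
    \<open>F\<close> demands; the sum of the \<open>H i\<close> is a Hoelder constant common to all
    directions.\<close>
  proof (rule that[of p "B + 1" "\<Sum>i\<in>UNIV. H i"])
    fix i and s t :: real assume "s \<noteq> t"
    have "H i \<le> (\<Sum>i\<in>UNIV. H i)" using H(1) by (intro member_le_sum) auto
    then have "H i * \<bar>s - t\<bar> powr (\<beta> $ i - of_int \<lfloor>\<beta> $ i\<rfloor>)
        \<le> (\<Sum>i\<in>UNIV. H i) * \<bar>s - t\<bar> powr (\<beta> $ i - of_int \<lfloor>\<beta> $ i\<rfloor>)"
      by (intro mult_right_mono) auto
    with H(2)[OF \<open>s \<noteq> t\<close>] show "\<bar>bump ((pderiv ^^ nat \<lfloor>\<beta> $ i\<rfloor>) p) s - bump ((pderiv ^^ nat \<lfloor>\<beta> $ i\<rfloor>) p) t\<bar>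
      \<le> (\<Sum>i\<in>UNIV. H i) * \<bar>s - t\<bar> powr (\<beta> $ i - of_int \<lfloor>\<beta> $ i\<rfloor>)"
      by (rule order_trans)
  next
    fix t show "\<bar>bump p t\<bar> \<le> B + 1" using B(2)[of t] by simp
  qed (use dvd B H(1) in \<open>auto simp: poly_p bump_def power2_eq_square sum_nonneg\<close>)
qed

text \<open>Seminorms are subadditive, so \<open>g\<close> and \<open>f\<close> may spend
  \<open>L $ i / 2\<close> each, and \<open>f\<close> leaves the total mass unchanged. Membership of
  \<open>g\<close> carries no sup bound, so the bound \<open>b\<close> is supplied pointwise for the
  sum.\<close>

lemma holder_density_perturbation:
  fixes \<beta> L w c :: "real ^ 'd" and g :: "real ^ 'd \<Rightarrow> real"
  assumes \<beta>: "\<forall>j. 0 < \<beta> $ j" and L: "\<forall>j. 0 < L $ j"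
    and g: "g \<in> holder_class \<beta> ((1 / 2) *\<^sub>R L) \<infinity>"
    and f: "\<And>i. has_partial_derivs i (nat \<lfloor>\<beta> $ i\<rfloor>) f"
      "\<And>i. holder_seminorm i (\<beta> $ i) f \<le> ennreal (L $ i / 2)"
    and meas: "g \<in> borel_measurable borel" "f \<in> borel_measurable borel"
    and bnd: "\<And>x. 0 \<le> g x + f x" "\<And>x. g x + f x \<le> b"
    and int: "integrable lborel g" "(\<integral>x. g x \<partial>lborel) = 1"
      "integrable lborel f" "(\<integral>x. f x \<partial>lborel) = 0"
  shows "(\<lambda>x. g x + f x) \<in> holder_densities \<beta> L (ennreal b)"
proof -
  have hp: "has_partial_derivs i (nat \<lfloor>\<beta> $ i\<rfloor>) g" for i
    using g by (auto simp: holder_class_def holder_space_def)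
  have semi: "holder_seminorm i (\<beta> $ i) (\<lambda>x. g x + f x) \<le> ennreal (L $ i)" for i
  proof -
    have "holder_seminorm i (\<beta> $ i) g \<le> ennreal (L $ i / 2)"
      using g by (auto simp: holder_class_def)
    then have "holder_seminorm i (\<beta> $ i) (\<lambda>x. g x + f x) \<le> ennreal (L $ i / 2) + ennreal (L $ i / 2)"
      using holder_seminorm_add[OF hp f(1)] f(2) by (meson add_mono order_trans)
    also have "\<dots> = ennreal (L $ i)"
      using L[rule_format, of i] by (subst ennreal_plus[symmetric]) auto
    finally show ?thesis .
  qed
  have "linf_norm (\<lambda>x. g x + f x) \<le> ennreal b"
    using meas bnd by (intro linf_norm_leI) auto
  moreover have "(\<integral>\<^sup>+x. ennreal (g x + f x) \<partial>lborel) = 1"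
    using int bnd(1) by (subst nn_integral_eq_integral) auto
  ultimately show ?thesis
    using semi hp f(1) meas bnd(1)
    by (auto simp: holder_densities_def holder_class_def holder_space_def
        intro!: has_partial_derivs_add order.strict_trans1[OF semi])
qed

text \<open>The bumps are lined up along a single coordinate axis: this already yields a number of
  hypotheses that is polynomial in the sample size.\<close>

lemma minimax_risk_ge_bump_height:
  fixes \<beta> L w x0 :: "real ^ 'd" and g :: "real ^ 'd \<Rightarrow> real"
  assumes \<beta>: "\<forall>j. 0 < \<beta> $ j" and L: "\<forall>j. 0 < L $ j" and b: "0 < b"
    and p: "\<And>i. [:1, 0, -1:] ^ (nat \<lfloor>\<beta> $ i\<rfloor> + 2) dvd p" "\<And>t. poly p (- t) = - poly p t"
    and F: "0 < F" "\<And>t. \<bar>bump p t\<bar> \<le> F" and top: "0 < bump p (1/2)"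
    and H: "0 \<le> H" "\<And>i s t. s \<noteq> t \<Longrightarrow>
      \<bar>bump ((pderiv ^^ nat \<lfloor>\<beta> $ i\<rfloor>) p) s - bump ((pderiv ^^ nat \<lfloor>\<beta> $ i\<rfloor>) p) t\<bar>
      \<le> H * \<bar>s - t\<bar> powr (\<beta> $ i - of_int \<lfloor>\<beta> $ i\<rfloor>)"
    and A: "0 < A" "A * F ^ (CARD('d) - 1) * H \<le> 1 / 2" and h: "0 < h"
    and w: "\<And>i. w $ i = (h / L $ i) powr (1 / \<beta> $ i)"
    and g: "g \<in> holder_class \<beta> ((1 / 2) *\<^sub>R L) \<infinity>" "continuous_on UNIV g" "\<And>x. 0 < g x" "\<And>x. g x \<le> b"
      "(\<integral>\<^sup>+x. ennreal (g x) \<partial>lborel) = 1"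
    and cube: "\<And>x. (\<And>i. \<bar>x $ i - x0 $ i\<bar> \<le> \<delta>) \<Longrightarrow> b / 4 \<le> g x \<and> g x \<le> 3 / 4 * b"
    and small: "A * h * F ^ CARD('d) \<le> b / 4" "\<And>i. w $ i \<le> \<delta>"
    and K: "0 < K" "2 * real K * w $ m \<le> \<delta>"
      "(1 + (A * h * F ^ CARD('d))\<^sup>2 / (b / 4) * (\<Prod>i\<in>UNIV. 2 * w $ i)) ^ n \<le> real K / 4"
  shows "ennreal (A * h * bump p (1/2) ^ CARD('d) / 8) \<le> minimax_risk n (holder_densities \<beta> L (ennreal b))"
proof -
  \<comment> \<open>Consecutive centres are \<open>2 * w $ m\<close> apart, so neighbouring boxes
    share a face, on which the bumps vanish.\<close>
  define c where "c = (\<lambda>k::nat. x0 + (2 * real k * w $ m) *\<^sub>R axis m 1)"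
  define \<gamma> where "\<gamma> = (\<lambda>k. box_bump p (A * h) w (c k))"
  have w0: "0 < w $ i" for i using w[of i] h L[rule_format, of i] by simp
  have p2: "[:1, 0, -1:] ^ 2 dvd p" by (rule power_le_dvd[OF p(1)]) simp
  have p1: "poly p 1 = 0" "poly p (-1) = 0"
  proof -
    obtain r where r: "p = [:1, 0, -1:] ^ 2 * r" using p2 by (elim dvdE)
    have "poly [:1, 0, -1:] (1::real) = 0" by simp
    then show "poly p 1 = 0" unfolding r poly_mult poly_power by (simp only:) simp
    then show "poly p (-1) = 0" using p(2)[of 1] by simp
  qed
  have a: "0 \<le> A * h" using A(1) h by simp
  have gm: "g \<in> borel_measurable borel" by (rule borel_measurable_continuous_onI[OF g(2)])
  have gi: "integrable lborel g" "(\<integral>x. g x \<partial>lborel) = 1"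
    using g(3,5) gm by (auto intro!: integrableI_nonneg simp: less_imp_le integral_eq_nn_integral)
  have \<gamma>m: "\<gamma> k \<in> borel_measurable borel" for k
    unfolding \<gamma>_def by (rule borel_measurable_box_bump[OF p2])
  have ck: "c k $ i = x0 $ i + (if i = m then 2 * real k * w $ m else 0)" for k i
    by (simp add: c_def axis_def)
  have in_cube: "\<bar>x $ i - x0 $ i\<bar> \<le> \<delta>" if k: "k < K" and x: "\<And>i. \<bar>x $ i - c k $ i\<bar> \<le> w $ i" for k x i
  proof (cases "i = m")
    case True
    \<comment> \<open>The centre is offset by \<open>2 * real k * w $ m\<close> and the box adds one
      more half-width; as \<open>k\<close> is at most \<open>K - 1\<close>, the total stays within
      the room granted for \<open>K\<close> bumps.\<close>
    have "(2 * real k + 1) * w $ m \<le> (2 * real K) * w $ m"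
      using k w0[of m] by (intro mult_right_mono) auto
    then have "2 * real k * w $ m + w $ m \<le> \<delta>" using K(2) by (simp add: distrib_right)
    moreover have "0 \<le> 2 * real k * w $ m" using w0[of m] by simp
    moreover have "\<bar>x $ m - (x0 $ m + 2 * real k * w $ m)\<bar> \<le> w $ m" using x[of m] by (simp add: ck)
    ultimately show ?thesis unfolding True by linarith
  next
    case False
    then show ?thesis using x[of i] small(2)[of i] by (simp add: ck)
  qed
  have \<gamma>b: "\<bar>\<gamma> k x\<bar> \<le> b / 4" for k x
    using abs_box_bump_le[OF a F(2), of w "c k" x] small(1) unfolding \<gamma>_def by linarith
  have supp: "\<bar>x $ i - c k $ i\<bar> \<le> w $ i" if "\<gamma> k x \<noteq> 0" for k x i
    using box_bump_support[OF w0] that unfolding \<gamma>_def by blast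
  have bnd: "0 \<le> g x + \<gamma> k x" "g x + \<gamma> k x \<le> b" if k: "k < K" for k x
  proof -
    have "0 \<le> g x + \<gamma> k x \<and> g x + \<gamma> k x \<le> b"
    proof (cases "\<gamma> k x = 0")
      case True
      then show ?thesis using g(3)[of x] g(4)[of x] by simp
    next
      case False
      have "b / 4 \<le> g x \<and> g x \<le> 3 / 4 * b"
        by (intro cube in_cube[OF k] supp[OF False])
      then show ?thesis using \<gamma>b[of k x] by linarith
    qed
    then show "0 \<le> g x + \<gamma> k x" "g x + \<gamma> k x \<le> b" by auto
  qed
  have ints: "integrable lborel (\<gamma> k)" "integrable lborel (\<lambda>x. (\<gamma> k x)\<^sup>2 / g x)"
    "(\<integral>x. (\<gamma> k x)\<^sup>2 / g x \<partial>lborel) \<le> (A * h * F ^ CARD('d))\<^sup>2 / (b / 4) * (\<Prod>i\<in>UNIV. 2 * w $ i)"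
    if k: "k < K" for k
  proof -
    have "b / 4 \<le> g x" if "\<And>i. \<bar>x $ i - c k $ i\<bar> \<le> w $ i" for x
      using cube[OF in_cube[OF k that]] by simp
    moreover have "0 < b / 4" using b by simp
    ultimately show "integrable lborel (\<gamma> k)" "integrable lborel (\<lambda>x. (\<gamma> k x)\<^sup>2 / g x)"
      "(\<integral>x. (\<gamma> k x)\<^sup>2 / g x \<partial>lborel) \<le> (A * h * F ^ CARD('d))\<^sup>2 / (b / 4) * (\<Prod>i\<in>UNIV. 2 * w $ i)"
      unfolding \<gamma>_def using box_bump_integrals[OF p2 w0 a F(2) gm g(3), of "b / 4" "c k"] by blast+
  qed
  have \<gamma>0: "(\<integral>x. \<gamma> k x \<partial>lborel) = 0" for k
    unfolding \<gamma>_def by (rule integral_box_bump_odd[OF p2 p(2)])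
  have semi: "holder_seminorm i (\<beta> $ i) (\<gamma> k) \<le> ennreal (L $ i / 2)" for i k
  proof -
    have "[:1, 0, -1:] ^ (nat \<lfloor>\<beta> $ i\<rfloor> + 1) dvd p" by (rule power_le_dvd[OF p(1)[of i]]) simp
    then have "holder_seminorm i (\<beta> $ i) (\<gamma> k)
        \<le> ennreal (A * h * F ^ (CARD('d) - 1) * H / w $ i powr \<beta> $ i)"
      unfolding \<gamma>_def using w0 \<beta> a F(2) H(2) by (intro holder_seminorm_box_bump) auto
    \<comment> \<open>This is the purpose of the widths: the quotient of height and
      \<open>w $ i powr \<beta> $ i\<close> is a multiple of \<open>L $ i\<close> that no longer
      depends on \<open>h\<close>.\<close>
    also have "w $ i powr \<beta> $ i = h / L $ i"
      using h L[rule_format, of i] \<beta>[rule_format, of i] by (simp add: w powr_powr)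
    also have "A * h * F ^ (CARD('d) - 1) * H / (h / L $ i) = (A * F ^ (CARD('d) - 1) * H) * L $ i"
      using h by simp
    also have "ennreal \<dots> \<le> ennreal (1 / 2 * L $ i)"
      using A(2) L by (intro ennreal_leI mult_right_mono) (auto simp: less_imp_le)
    finally show ?thesis by simp
  qed
  \<comment> \<open>The trivial perturbation shows that the Gaussian itself lies in the class, sup
    bound included.\<close>
  have zero: "(\<lambda>x. g x + 0) \<in> holder_densities \<beta> L (ennreal b)"
  proof (rule holder_density_perturbation[OF \<beta> L g(1)])
    have pd: "(partial_deriv i ^^ k) (\<lambda>_. 0) = (\<lambda>_. 0)" for i :: 'd and k
      by (induction k) (auto simp: partial_deriv_def)
    show "has_partial_derivs i (nat \<lfloor>\<beta> $ i\<rfloor>) (\<lambda>_. 0)" for i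
      by (simp add: has_partial_derivs_def pd)
    show "holder_seminorm i (\<beta> $ i) (\<lambda>_. 0) \<le> ennreal (L $ i / 2)" for i
      unfolding holder_seminorm_def pd by (intro SUP_least) simp
  qed (use gm g gi in \<open>auto simp: less_imp_le\<close>)
  have "ennreal (A * h * bump p (1/2) ^ CARD('d) / 2 / 4)
      \<le> minimax_risk n (holder_densities \<beta> L (ennreal b))"
  proof (rule minimax_lower_bound[where g = g and \<gamma> = \<gamma> and K = K])
    show "g \<in> holder_densities \<beta> L (ennreal b)" using zero by simp
    show "(\<lambda>x. g x + \<gamma> k x) \<in> holder_densities \<beta> L (ennreal b)" if k: "k < K" for k
    proof (rule holder_density_perturbation[OF \<beta> L g(1) _ semi gm \<gamma>m bnd[OF k] gi ints(1)[OF k] \<gamma>0])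
      fix i show "has_partial_derivs i (nat \<lfloor>\<beta> $ i\<rfloor>) (\<gamma> k)"
        unfolding \<gamma>_def using w0[of i] by (intro has_partial_derivs_box_bump p(1)) simp
    qed
    show "\<gamma> k x * \<gamma> l x = 0" if "k \<noteq> l" for k l x
    proof (rule ccontr)
      assume "\<gamma> k x * \<gamma> l x \<noteq> 0"
      then have "\<bar>x $ m - c k $ m\<bar> < w $ m" "\<bar>x $ m - c l $ m\<bar> < w $ m"
        unfolding \<gamma>_def by (auto intro!: box_bump_support_strict w0 p1)
      then have "\<bar>c k $ m - c l $ m\<bar> < 2 * w $ m" by linarith
      also have "c k $ m - c l $ m = (real k - real l) * (2 * w $ m)" by (simp add: ck algebra_simps)
      finally have "\<bar>real k - real l\<bar> < 1" using w0[of m] by (simp add: abs_mult)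
      then show False using \<open>k \<noteq> l\<close> by linarith
    qed
    show "ennreal (2 * (A * h * bump p (1/2) ^ CARD('d) / 2)) \<le> linf_norm (\<gamma> k)" for k
    proof -
      \<comment> \<open>Half a width away from the centre in every direction, each factor takes its
        value at 1/2.\<close>
      define y where "y = c k + (1/2) *\<^sub>R w"
      have "(y $ i - c k $ i) / w $ i = 1 / 2" for i using w0[of i] by (simp add: y_def)
      then have "\<gamma> k y = A * h * bump p (1/2) ^ CARD('d)" by (simp only: \<gamma>_def box_bump_def prod_constant)
      then have "ennreal (A * h * bump p (1/2) ^ CARD('d)) \<le> ennreal \<bar>\<gamma> k y\<bar>"
        by (intro ennreal_leI) simp
      also have "\<dots> \<le> linf_norm (\<gamma> k)"
        unfolding \<gamma>_def by (intro linf_norm_ge_at continuous_on_box_bump p2)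
      finally show ?thesis by simp
    qed
  qed (use K gm \<gamma>m g(3,5) bnd(1) ints \<gamma>0 a top in \<open>auto intro: mult_nonneg_nonneg\<close>)
  then show ?thesis by simp
qed

subsection \<open>Choice of the bump height\<close>

text \<open>With x = (ln n) / n, the product n^\<alpha> * x^(2 \<alpha>) equals (ln n / sqrt n)^(2
  \<alpha>) and tends to 0, while the left side is at most 5 n^\<alpha>. The 4 answers to the
  condition \<open>K / 4\<close>, the 1 pays for rounding the number of bumps down.\<close>

lemma powr_dominated_by_log_ratio:
  fixes D \<alpha> :: real
  assumes "0 < D" "0 < \<alpha>"
  shows "\<forall>\<^sub>F n in sequentially. 4 * real n powr \<alpha> + 1 \<le> D / (ln (real n) / real n) powr (2 * \<alpha>)"
proof -
  have "(\<lambda>n. (ln (real n) / real n powr (1/2)) powr (2 * \<alpha>)) \<longlonglongrightarrow> 0"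
    using assms lim_ln_over_power[of "1/2"]
    by (intro tendsto_zero_powrI[where b = "2 * \<alpha>"])
      (auto simp: eventually_sequentially intro!: exI[of _ 1])
  then have "\<forall>\<^sub>F n in sequentially. (ln (real n) / real n powr (1/2)) powr (2 * \<alpha>) < D / 5"
    using assms by (intro order_tendstoD(2)) auto
  then show ?thesis
    using eventually_ge_at_top[of 2]
  proof eventually_elim
    case (elim n)
    have n: "0 < ln (real n)" "1 \<le> real n powr \<alpha>"
      using elim(2) assms by (auto intro!: ge_one_powr_ge_zero)
    have x: "0 < (ln (real n) / real n) powr (2 * \<alpha>)" using n(1) elim(2) by simp
    have "5 * (real n powr \<alpha> * (ln (real n) / real n) powr (2 * \<alpha>))
        = 5 * (ln (real n) / real n powr (1/2)) powr (2 * \<alpha>)"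
    proof -
      have "real n powr \<alpha> = (real n powr (1/2)) powr (2 * \<alpha>)" by (simp add: powr_powr)
      also have "\<dots> * (ln (real n) / real n) powr (2 * \<alpha>)
          = (real n powr (1/2) * (ln (real n) / real n)) powr (2 * \<alpha>)"
        using n elim(2) by (subst powr_mult) auto
      also have "real n powr (1/2) * (ln (real n) / real n) = ln (real n) / real n powr (1/2)"
      proof -
        have "real n = real n powr (1/2) * real n powr (1/2)"
          using elim(2) by (simp add: powr_add[symmetric])
        then show ?thesis using elim(2) by (simp add: field_simps)
      qed
      finally show ?thesis by simp
    qed
    also have "\<dots> \<le> D" using elim(1) by simp
    finally have "5 * real n powr \<alpha> \<le> D / (ln (real n) / real n) powr (2 * \<alpha>)"
      using x by (simp add: field_simps)
    then show ?case using n(2) by linarith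
  qed
qed

lemma power_one_plus_log_ratio_le:
  fixes \<alpha> :: real
  assumes "0 \<le> \<alpha>" "2 \<le> n"
  shows "(1 + \<alpha> * (ln (real n) / real n)) ^ n \<le> real n powr \<alpha>"
proof -
  have "(1 + \<alpha> * (ln (real n) / real n)) ^ n \<le> exp (\<alpha> * (ln (real n) / real n)) ^ n"
    using assms by (intro power_mono exp_ge_add_one_self) (auto intro!: add_nonneg_nonneg mult_nonneg_nonneg)
  also have "\<dots> = exp (real n * (\<alpha> * (ln (real n) / real n)))" by (rule exp_of_nat_mult[symmetric])
  also have "\<dots> = real n powr \<alpha>" using assms by (simp add: powr_def)
  finally show ?thesis .
qed

theorem theorem7:
  fixes \<beta> :: "real ^ 'd" and \<beta>m :: real
  assumes "\<forall>j. 0 < \<beta> $ j"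
    and "1 / \<beta>m = 1 / real CARD('d) * (\<Sum>j\<in>UNIV. 1 / \<beta> $ j)"
  shows "\<exists>C>0. \<forall>(L :: real ^ 'd) (b :: real).
     (\<forall>j. 0 < L $ j) \<longrightarrow> 0 < b \<longrightarrow> gaussian_with_peak b \<in> holder_class \<beta> ((1 / 2) *\<^sub>R L) \<infinity> \<longrightarrow>
     (\<forall>\<^sub>F n in sequentially.
        ennreal (C * b powr (\<beta>m / (2 * \<beta>m + real CARD('d)))
          * (\<Prod>j\<in>UNIV. (L $ j) powr (\<beta>m / \<beta> $ j)) powr (1 / (2 * \<beta>m + real CARD('d)))
          * (ln (real n) / real n) powr (\<beta>m / (2 * \<beta>m + real CARD('d))))
        \<le> minimax_risk n (holder_densities \<beta> L (ennreal b)))"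
proof -
  note \<beta> = assms(1)[rule_format]
  let ?d = "real CARD('d)"
  define \<theta> where "\<theta> = \<beta>m / (2 * \<beta>m + ?d)"
  have "0 < (\<Sum>j\<in>UNIV. 1 / \<beta> $ j)" using \<beta> by (intro sum_pos) auto
  then have "0 < 1 / \<beta>m" unfolding assms(2) by simp
  then have \<beta>m: "0 < \<beta>m" by simp
  have sum_eq: "(\<Sum>j\<in>UNIV. 1 / \<beta> $ j) = ?d / \<beta>m"
    using assms(2) \<beta>m by (simp add: field_simps)
  have \<theta>: "0 < \<theta>" unfolding \<theta>_def using \<beta>m by simp
  \<comment> \<open>This balance of exponents inverts the choice of \<open>h\<close> below:
    \<open>h\<close> is a power with exponent \<open>\<theta>\<close>, and height squared times
    volume is of order \<open>h\<close> to the power \<open>2 + ?d / \<beta>m\<close>.\<close>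
  have \<theta>_inv: "\<theta> * (2 + ?d / \<beta>m) = 1"
  proof -
    have "2 + ?d / \<beta>m = (2 * \<beta>m + ?d) / \<beta>m" using \<beta>m by (simp add: field_simps)
    moreover have "2 * \<beta>m + ?d \<noteq> 0" using \<beta>m add_pos_nonneg[of "2 * \<beta>m" ?d] by simp
    ultimately show ?thesis unfolding \<theta>_def using \<beta>m by simp
  qed
  obtain p F H where
    p: "\<And>i. [:1, 0, -1:] ^ (nat \<lfloor>\<beta> $ i\<rfloor> + 2) dvd p" "\<And>t. poly p (- t) = - poly p t"
    and F0: "0 < F" and H0: "0 \<le> H" and F1: "\<And>t. \<bar>bump p t\<bar> \<le> F"
    and top: "0 < bump p (1/2)" and H1: "\<And>i s t. s \<noteq> t \<Longrightarrow>
      \<bar>bump ((pderiv ^^ nat \<lfloor>\<beta> $ i\<rfloor>) p) s - bump ((pderiv ^^ nat \<lfloor>\<beta> $ i\<rfloor>) p) t\<bar>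
      \<le> H * \<bar>s - t\<bar> powr (\<beta> $ i - of_int \<lfloor>\<beta> $ i\<rfloor>)"
    by (rule bump_profile[OF assms(1)]) blast
  note F = F0 F1 and H = H0 H1
  define G where "G = F ^ (CARD('d) - 1) * H"
  have G: "0 \<le> G" unfolding G_def using F(1) H(1) by simp
  \<comment> \<open>The bumps may use half of the Hoelder budget, so \<open>A * G\<close> must not
    exceed 1/2; the 1 covers \<open>G = 0\<close>.\<close>
  define A where "A = 1 / (2 * (G + 1))"
  have A: "0 < A" "A * F ^ (CARD('d) - 1) * H \<le> 1 / 2"
    using G unfolding A_def mult.assoc G_def[symmetric] by (auto simp: field_simps)
  obtain i0 :: 'd where True by simp
  \<comment> \<open>Half the exponent of (ln n) / n in the width along \<open>i0\<close>, the
    arbitrary direction in which the bumps are lined up. Any proper fraction would keep n^\<alpha>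
    below the number of bumps for large n.\<close>
  define \<alpha> where "\<alpha> = \<theta> / (2 * \<beta> $ i0)"
  have \<alpha>: "0 < \<alpha>" unfolding \<alpha>_def using \<theta> \<beta>[of i0] by simp
  \<comment> \<open>The divergence is \<open>B / b\<close> times h^2 * prod w_i: the 4 stems from
    the lower bound b/4 of the density, the power of 2 from the side lengths
    \<open>2 * w $ i\<close>.\<close>
  define B where "B = 4 * (A * F ^ CARD('d))\<^sup>2 * 2 ^ CARD('d)"
  have B: "0 < B" unfolding B_def using A(1) F(1) by simp
  \<comment> \<open>With bump height \<open>h\<close> below, this makes the chi-square divergence from the Gaussian, per
    observation, equal to \<open>\<alpha> ln n / n\<close>; the \<open>n\<close>-sample divergence is then of order \<open>n\<^sup>\<alpha>\<close>, whereas the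
    number of bumps is of order \<open>(n / ln n)\<close> to the power \<open>2 \<alpha>\<close>.\<close>
  define h0 where "h0 = (\<alpha> / B) powr \<theta>"
  have h0: "0 < h0" unfolding h0_def using \<alpha> B by simp
  define C where "C = A * h0 * bump p (1/2) ^ CARD('d) / 8"
  have "0 < C" unfolding C_def using A(1) h0 top by simp
  moreover have "\<forall>\<^sub>F n in sequentially.
        ennreal (C * b powr (\<beta>m / (2 * \<beta>m + ?d))
          * (\<Prod>j\<in>UNIV. (L $ j) powr (\<beta>m / \<beta> $ j)) powr (1 / (2 * \<beta>m + ?d))
          * (ln (real n) / real n) powr (\<beta>m / (2 * \<beta>m + ?d)))
        \<le> minimax_risk n (holder_densities \<beta> L (ennreal b))"
    if L: "\<forall>j. 0 < L $ j" and b: "0 < b"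
      and gc: "gaussian_with_peak b \<in> holder_class \<beta> ((1 / 2) *\<^sub>R L) \<infinity>" for L :: "real ^ 'd" and b :: real
  proof -
    define g where "g = (gaussian_with_peak b :: real ^ 'd \<Rightarrow> real)"
    note gp = gaussian_with_peak_props[OF b, where 'd='d, folded g_def]
    obtain x0 where x0: "g x0 = b / 2" using gp(5) by auto
    \<comment> \<open>\<open>\<delta>\<close> depends on \<open>b\<close>, but enters only
      conditions that hold for all large n, never \<open>C\<close>.\<close>
    obtain \<delta> where \<delta>: "0 < \<delta>" "\<And>x. (\<And>i. \<bar>x $ i - x0 $ i\<bar> \<le> \<delta>) \<Longrightarrow> \<bar>g x - g x0\<bar> \<le> b / 4"
      using continuous_cube_neighbourhood[OF gp(2), of "b / 4" x0] b by auto
    have cube: "b / 4 \<le> g x \<and> g x \<le> 3 / 4 * b" if "\<And>i. \<bar>x $ i - x0 $ i\<bar> \<le> \<delta>" for x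
      using \<delta>(2)[OF that] unfolding x0 by linarith
    define S where "S = (\<Prod>j\<in>UNIV. L $ j powr (1 / \<beta> $ j))"
    have S: "0 < S" unfolding S_def using L by (intro prod_pos) (simp add: less_imp_neq[symmetric])
    define x where "x = (\<lambda>n. ln (real n) / real n)"
    define h where "h = (\<lambda>n. h0 * (b * S * x n) powr \<theta>)"
    define w where "w = (\<lambda>n. (\<chi> i. (h n / L $ i) powr (1 / \<beta> $ i)) :: real ^ 'd)"
    \<comment> \<open>The factor of the width along \<open>i0\<close> that is free of n.\<close>
    define W where "W = (h0 * (b * S) powr \<theta> / L $ i0) powr (1 / \<beta> $ i0)"
    have W: "0 < W" unfolding W_def using h0 b S L[rule_format, of i0] by simp
    \<comment> \<open>At n = 1 the logarithm vanishes and the bumps would have height 0.\<close>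
    have x_pos: "0 < x n" if "2 \<le> n" for n using that unfolding x_def by simp
    have x_lim: "x \<longlonglongrightarrow> 0" unfolding x_def by (rule lim_ln_over_n)
    have "(\<lambda>n. (b * S * x n) powr \<theta>) \<longlonglongrightarrow> 0"
    proof (rule tendsto_zero_powrI)
      show "(\<lambda>n. b * S * x n) \<longlonglongrightarrow> 0" using tendsto_mult_left[OF x_lim, of "b * S"] by simp
      show "\<forall>\<^sub>F n in sequentially. 0 \<le> b * S * x n"
        using eventually_ge_at_top[of 2]
        by eventually_elim (use b S x_pos in \<open>simp add: less_imp_le\<close>)
    qed (use \<theta> in \<open>auto intro: tendsto_const\<close>)
    then have h_lim: "h \<longlonglongrightarrow> 0" unfolding h_def using tendsto_mult_left[of _ 0 _ h0] by simp
    have h_pos: "0 < h n" if "2 \<le> n" for n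
      unfolding h_def using h0 b S x_pos[OF that] by simp
    have w_lim: "(\<lambda>n. w n $ i) \<longlonglongrightarrow> 0" for i
    proof -
      have "(\<lambda>n. (h n / L $ i) powr (1 / \<beta> $ i)) \<longlonglongrightarrow> 0"
      proof (rule tendsto_zero_powrI[where b = "1 / \<beta> $ i"])
        show "(\<lambda>n. h n / L $ i) \<longlonglongrightarrow> 0" using tendsto_divide[OF h_lim tendsto_const, of "L $ i"] L[rule_format, of i] by simp
        show "\<forall>\<^sub>F n in sequentially. 0 \<le> h n / L $ i"
          using eventually_ge_at_top[of 2]
          by eventually_elim (use L[rule_format, of i] h_pos in \<open>simp add: less_imp_le\<close>)
      qed (use \<beta>[of i] in \<open>auto intro: tendsto_const\<close>)
      then show ?thesis unfolding w_def by simp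
    qed
    have ev_h: "\<forall>\<^sub>F n in sequentially. h n < b / 4 / (A * F ^ CARD('d))"
      using h_lim b A(1) F(1) by (intro order_tendstoD(2)) auto
    have ev_w: "\<forall>\<^sub>F n in sequentially. \<forall>i. w n $ i < \<delta>"
      using w_lim \<delta>(1) by (intro eventually_all_finite order_tendstoD(2)) auto
    have ev_K: "\<forall>\<^sub>F n in sequentially. 4 * real n powr \<alpha> + 1 \<le> (\<delta> / (2 * W)) / x n powr (2 * \<alpha>)"
      unfolding x_def using \<delta>(1) W \<alpha> by (intro powr_dominated_by_log_ratio) auto
    show ?thesis
      using ev_h ev_w ev_K eventually_ge_at_top[of 2]
    proof eventually_elim
      case (elim n)
      note n = elim(4)
      note xn = x_pos[OF n] and hn = h_pos[OF n]
      have w0: "0 < w n $ i" for i using hn L[rule_format, of i] by (simp add: w_def)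
      have w_i0: "w n $ i0 = W * x n powr (2 * \<alpha>)"
      proof -
        have "h n / L $ i0 = (h0 * (b * S) powr \<theta> / L $ i0) * x n powr \<theta>"
          using b S xn by (simp add: h_def powr_mult)
        then have "w n $ i0 = W * (x n powr \<theta>) powr (1 / \<beta> $ i0)"
          using h0 b S L[rule_format, of i0] by (simp only: w_def W_def vec_lambda_beta) (subst powr_mult, auto)
        then show ?thesis by (simp add: powr_powr \<alpha>_def)
      qed
      \<comment> \<open>As many boxes of side \<open>2 * w n $ i0\<close> as fit into the length
        \<open>\<delta>\<close>.\<close>
      define K where "K = nat \<lfloor>\<delta> / (2 * w n $ i0)\<rfloor>"
      have K1: "real K \<le> \<delta> / (2 * w n $ i0)"
        unfolding K_def using w0[of i0] \<delta>(1) by (intro of_nat_floor) simp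
      have K2: "4 * real n powr \<alpha> \<le> real K"
      proof -
        have "\<delta> / (2 * w n $ i0) - 1 \<le> real K" unfolding K_def by linarith
        moreover have "\<delta> / (2 * w n $ i0) = (\<delta> / (2 * W)) / x n powr (2 * \<alpha>)" by (simp add: w_i0)
        ultimately show ?thesis using elim(3) by linarith
      qed
      have "0 < real n powr \<alpha>" using n by simp
      then have "0 < K" using K2 by (cases K) auto
      have "(\<Prod>i\<in>UNIV. w n $ i) = h n powr (?d / \<beta>m) / S"
      proof -
        have "(\<Prod>i\<in>UNIV. w n $ i) = (\<Prod>i\<in>UNIV. h n powr (1 / \<beta> $ i)) / S"
          using hn L unfolding w_def S_def by (simp add: powr_divide less_imp_le prod_dividef)
        also have "(\<Prod>i\<in>UNIV. h n powr (1 / \<beta> $ i)) = h n powr (?d / \<beta>m)"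
          using hn by (simp add: powr_sum[symmetric] sum_eq)
        finally show ?thesis .
      qed
      moreover have "(h n)\<^sup>2 * h n powr (?d / \<beta>m) = \<alpha> / B * (b * S * x n)"
      proof -
        have "(h n)\<^sup>2 * h n powr (?d / \<beta>m) = h n powr (2 + ?d / \<beta>m)"
          using hn by (simp add: powr_add)
        also have "\<dots> = ((\<alpha> / B * (b * S * x n)) powr \<theta>) powr (2 + ?d / \<beta>m)"
          unfolding h_def h0_def using \<alpha> B b S xn by (subst (2) powr_mult) auto
        also have "\<dots> = \<alpha> / B * (b * S * x n)"
          using \<alpha> B b S xn unfolding powr_powr \<theta>_inv by simp
        finally show ?thesis .
      qed
      ultimately have wh: "(h n)\<^sup>2 * (\<Prod>i\<in>UNIV. w n $ i) = \<alpha> / B * b * x n" using S by simp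
      have chi: "(A * h n * F ^ CARD('d))\<^sup>2 / (b / 4) * (\<Prod>i\<in>UNIV. 2 * w n $ i) = \<alpha> * x n"
      proof -
        have "(A * h n * F ^ CARD('d))\<^sup>2 / (b / 4) * (\<Prod>i\<in>UNIV. 2 * w n $ i)
            = B / b * ((h n)\<^sup>2 * (\<Prod>i\<in>UNIV. w n $ i))"
          unfolding prod.distrib B_def by (simp add: power_mult_distrib)
        also have "\<dots> = \<alpha> * x n" unfolding wh using B b by simp
        finally show ?thesis .
      qed
      have "ennreal (A * h n * bump p (1/2) ^ CARD('d) / 8) \<le> minimax_risk n (holder_densities \<beta> L (ennreal b))"
      proof (rule minimax_risk_ge_bump_height[where w = "w n" and \<delta> = \<delta> and K = K and m = i0 and g = g and F = F and H = H,
            OF assms(1) L b p F top H A hn _ _ gp(2,1,4,3) cube _ _ \<open>0 < K\<close>])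
        show "g \<in> holder_class \<beta> ((1 / 2) *\<^sub>R L) \<infinity>" unfolding g_def by (rule gc)
        show "A * h n * F ^ CARD('d) \<le> b / 4"
          using elim(1) A(1) F(1) by (simp add: field_simps)
        show "w n $ i \<le> \<delta>" for i using elim(2) by (simp add: less_imp_le)
        show "2 * real K * w n $ i0 \<le> \<delta>" using K1 w0[of i0] by (simp add: field_simps)
        have "(1 + \<alpha> * x n) ^ n \<le> real n powr \<alpha>"
          unfolding x_def using \<alpha> n by (intro power_one_plus_log_ratio_le) auto
        then show "(1 + (A * h n * F ^ CARD('d))\<^sup>2 / (b / 4) * (\<Prod>i\<in>UNIV. 2 * w n $ i)) ^ n \<le> real K / 4"
          unfolding chi using K2 by simp
      qed (simp_all add: w_def)
      moreover have "C * b powr (\<beta>m / (2 * \<beta>m + ?d))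
          * (\<Prod>j\<in>UNIV. (L $ j) powr (\<beta>m / \<beta> $ j)) powr (1 / (2 * \<beta>m + ?d))
          * (ln (real n) / real n) powr (\<beta>m / (2 * \<beta>m + ?d)) = A * h n * bump p (1/2) ^ CARD('d) / 8"
      \<comment> \<open>The product over \<open>L\<close> is \<open>S powr \<beta>m\<close>, so its
        outer exponent turns it into \<open>S powr \<theta>\<close>, the same exponent as on
        \<open>b\<close> and on (ln n) / n.\<close>
      proof -
        have "(\<Prod>j\<in>UNIV. (L $ j) powr (\<beta>m / \<beta> $ j)) = S powr \<beta>m"
          unfolding S_def by (simp add: prod_powr_distrib powr_powr)
        then have "(\<Prod>j\<in>UNIV. (L $ j) powr (\<beta>m / \<beta> $ j)) powr (1 / (2 * \<beta>m + ?d)) = S powr \<theta>"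
          by (simp add: powr_powr \<theta>_def)
        moreover have "ln (real n) / real n = x n" by (simp add: x_def)
        ultimately show ?thesis
          unfolding \<theta>_def[symmetric] C_def h_def
          using b S xn by (simp add: powr_mult)
      qed
      ultimately show ?case by (simp only:)
    qed
  qed
  ultimately show ?thesis by blast
qed

end
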